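(* Let $(X,\mu,T)$ be an ergodic $\mathbb{G}$-TDS and $f\in L^2(X,\mu)$. The following are equivalent: (1) $(X,T)$ is $\mu$-$f$-mean sensitive. (2) $(X,T)$ is $\mu$-$f$-mean expansive. (3) There exists $\varepsilon>0$ such that for $\mu$-almost every $x$, $\mu(B_\varepsilon^f(x))=0$, where $B_\varepsilon^f(x)=\{y:d_f(x,y)\le\varepsilon\}$. (4) $(X,T)$ is not $\mu$-$f$-mean equicontinuous.
   Context: $\mathbb{G}$ is a locally compact abelian group (written additively, identity $e$) with Haar measure $\nu$. A Følner sequence is a sequence $(F_n)_{n\in\mathbb{N}}$ of measurable subsets of $\mathbb{G}$ with $0<\nu(F_n)<\infty$ and $\nu((g+F_n)\triangle F_n)/\nu(F_n)\to 0$ for every $g\in\mathbb{G}$. A Følner sequence $(F_n)$ is fixed that satisfies the pointwise ergodic theorem: for every ergodic measure preserving $\mathbb{G}$-action $T$ on a standard probability space $(X,\mu)$ and every $f\in L^1(X,\mu)$, for $\mu$-a.e. $x$, $\frac{1}{\nu(F_n)}\int_{F_n} f(T^jx)\,d\nu(j)\to\int f\,d\mu$; a point $x$ at which this convergence holds is called generic for $f$. The upper density of $S\subset\mathbb{G}$ is $\overline{D}(S)=\limsup_n \nu(S\cap F_n)/\nu(F_n)$. A $\mathbb{G}$-TDS is a pair $(X,T)$ with $X$ a compact metric space (metric $d$) and $T:\mathbb{G}\times X\to X$, $(j,x)\mapsto T^jx$, a group action (jointly Borel measurable) with each $T^j:X\to X$ continuous. An ergodic $\mathbb{G}$-TDS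 $(X,\mu,T)$ is a $\mathbb{G}$-TDS with a Borel probability measure $\mu$ that is invariant under every $T^j$ and ergodic. $L^2(X,\mu)$ consists of complex-valued functions. For $f\in L^2(X,\mu)$ (a fixed representative) define $d_f(x,y)=\limsup_n\left(\frac{1}{\nu(F_n)}\int_{F_n}|f(T^jx)-f(T^jy)|^2d\nu(j)\right)^{1/2}$; whenever $d_f$ is used, only points generic for $|f|^2$ (a set of full measure) are considered. $(X,T)$ is $\mu$-$f$-mean sensitive if there is $\varepsilon>0$ such that for every Borel $A$ with $\mu(A)>0$ there exist $x,y\in A$ with $d_f(x,y)>\varepsilon$. $(X,T)$ is $\mu$-$f$-mean expansive if there is $\varepsilon>0$ with $(\mu\times\mu)(\{(x,y):d_f(x,y)>\varepsilon\})=1$. Define $\rho_f(x,y)=\inf\{\varepsilon>0:\overline{D}(\{i\in\mathbb{G}:|f(T^ix)-f(T^iy)|>\varepsilon\})<\varepsilon\}$. $(X,T)$ is $\mu$-$f$-mean equicontinuous if for every $\tau>0$ there is a compact $M\subset X$ with $\mu(M)\ge1-\tau$ such that for every $\varepsilon>0$ there is $\delta>0$ such that $x,y\in M$ and $d(x,y)\le\delta$ imply $\rho_f(x,y)\le\varepsilon$. *)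

theory Defs
  imports "HOL-Probability.Probability"
begin

section \<open>Haar measure and Folner sequences\<close>

text \<open>
  A Haar measure on the Borel sets: a nonzero, translation invariant Radon measure, that is,
  locally finite, outer regular on Borel sets and inner regular on open sets.
\<close>

definition haar_measure :: "'g::topological_ab_group_add measure \<Rightarrow> bool" where
  "haar_measure \<nu> \<longleftrightarrow>
     sets \<nu> = sets borel \<and>
     emeasure \<nu> UNIV \<noteq> 0 \<and>
     (\<forall>K. compact K \<longrightarrow> K \<in> sets borel \<longrightarrow> emeasure \<nu> K < \<infinity>) \<and>
     (\<forall>A\<in>sets borel. emeasure \<nu> A = (INF U\<in>{U. open U \<and> A \<subseteq> U}. emeasure \<nu> U)) \<and>
     (\<forall>U. open U \<longrightarrow>
        emeasure \<nu> U = (SUP K\<in>{K. compact K \<and> K \<in> sets borel \<and> K \<subseteq> U}. emeasure \<nu> K)) \<and>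
     (\<forall>g. \<forall>A\<in>sets borel. emeasure \<nu> ((\<lambda>h. g + h) ` A) = emeasure \<nu> A)"

definition folner_sequence ::
    "'g::topological_ab_group_add measure \<Rightarrow> (nat \<Rightarrow> 'g set) \<Rightarrow> bool" where
  "folner_sequence \<nu> F \<longleftrightarrow>
     (\<forall>n. F n \<in> sets \<nu> \<and> 0 < emeasure \<nu> (F n) \<and> emeasure \<nu> (F n) < \<infinity>) \<and>
     (\<forall>g. (\<lambda>n. measure \<nu> (sym_diff ((\<lambda>h. g + h) ` F n) (F n)) / measure \<nu> (F n))
            \<longlonglongrightarrow> 0)"

definition upper_density :: "'g measure \<Rightarrow> (nat \<Rightarrow> 'g set) \<Rightarrow> 'g set \<Rightarrow> ereal" where
  "upper_density \<nu> F S = limsup (\<lambda>n. ereal (measure \<nu> (S \<inter> F n) / measure \<nu> (F n)))"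

section \<open>Actions, ergodicity, generic points\<close>

text \<open>
  A measurable action of the group on the measurable space of \<open>M\<close> that preserves \<open>M\<close>.
  If \<open>M\<close> carries the Borel sets of a second countable space, the product sigma-algebra
  below is the Borel sigma-algebra of the product space, even if the group is not second
  countable.
\<close>

definition measure_preserving_action ::
    "'a measure \<Rightarrow> ('g::topological_ab_group_add \<Rightarrow> 'a \<Rightarrow> 'a) \<Rightarrow> bool" where
  "measure_preserving_action M T \<longleftrightarrow>
     (\<lambda>(j, x). T j x) \<in> borel \<Otimes>\<^sub>M M \<rightarrow>\<^sub>M M \<and>
     (\<forall>x\<in>space M. T 0 x = x) \<and>
     (\<forall>i j. \<forall>x\<in>space M. T (i + j) x = T i (T j x)) \<and>
     (\<forall>j. \<forall>A\<in>sets M. emeasure M (T j -` A \<inter> space M) = emeasure M A)"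

definition ergodic_action ::
    "'a measure \<Rightarrow> ('g::topological_ab_group_add \<Rightarrow> 'a \<Rightarrow> 'a) \<Rightarrow> bool" where
  "ergodic_action M T \<longleftrightarrow>
     prob_space M \<and> measure_preserving_action M T \<and>
     (\<forall>A\<in>sets M. (\<forall>j. emeasure M (sym_diff (T j -` A \<inter> space M) A) = 0) \<longrightarrow>
        emeasure M A = 0 \<or> emeasure M A = 1)"

text \<open>
  Genericity includes that the averages exist, because the Bochner integral of a
  non-integrable function is 0 by convention.
\<close>

definition generic_point ::
    "'g measure \<Rightarrow> (nat \<Rightarrow> 'g set) \<Rightarrow> 'a measure \<Rightarrow> ('g \<Rightarrow> 'a \<Rightarrow> 'a) \<Rightarrow>
     ('a \<Rightarrow> 'b::{banach, second_countable_topology}) \<Rightarrow> 'a \<Rightarrow> bool" where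
  "generic_point \<nu> F M T f x \<longleftrightarrow>
     (\<forall>n. set_integrable \<nu> (F n) (\<lambda>j. f (T j x))) \<and>
     (\<lambda>n. (LINT j:F n|\<nu>. f (T j x)) /\<^sub>R measure \<nu> (F n)) \<longlonglongrightarrow> (\<integral>z. f z \<partial>M)"

text \<open>
  The pointwise ergodic theorem quantifies over all standard probability spaces. Since one
  cannot quantify over types, these are represented by the Borel probability measures on Borel
  subsets of the Polish space \<^typ>\<open>nat \<Rightarrow> real\<close>: every Polish space is homeomorphic to a
  Borel (in fact G-delta) subset of it, so every standard Borel space is isomorphic to
  such a subset.
\<close>

definition standard_probability_space :: "(nat \<Rightarrow> real) measure \<Rightarrow> bool" where
  "standard_probability_space M \<longleftrightarrow>
     prob_space M \<and> space M \<in> sets borel \<and> sets M = sets (restrict_space borel (space M))"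

definition satisfies_pointwise_ergodic_theorem ::
    "'g::topological_ab_group_add measure \<Rightarrow> (nat \<Rightarrow> 'g set) \<Rightarrow> bool" where
  "satisfies_pointwise_ergodic_theorem \<nu> F \<longleftrightarrow>
     (\<forall>(M :: (nat \<Rightarrow> real) measure) T (f :: (nat \<Rightarrow> real) \<Rightarrow> complex).
        standard_probability_space M \<longrightarrow> ergodic_action M T \<longrightarrow> integrable M f \<longrightarrow>
        (AE x in M. generic_point \<nu> F M T f x))"

definition ergodic_TDS ::
    "'x::metric_space measure \<Rightarrow> ('g::topological_ab_group_add \<Rightarrow> 'x \<Rightarrow> 'x) \<Rightarrow> bool" where
  "ergodic_TDS \<mu> T \<longleftrightarrow>
     compact (UNIV :: 'x set) \<and> sets \<mu> = sets borel \<and>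
     (\<forall>j. continuous_on UNIV (T j)) \<and> ergodic_action \<mu> T"

definition square_integrable :: "'a measure \<Rightarrow> ('a \<Rightarrow> complex) \<Rightarrow> bool" where
  "square_integrable M f \<longleftrightarrow>
     f \<in> borel_measurable M \<and> integrable M (\<lambda>x. (cmod (f x))\<^sup>2)"

section \<open>Mean sensitivity, expansivity and equicontinuity with respect to a function\<close>

text \<open>
  The points at which \<open>mean_dist\<close> is considered; everything below that involves
  \<open>mean_dist\<close> is restricted to them.
\<close>

definition generic_set ::
    "'g measure \<Rightarrow> (nat \<Rightarrow> 'g set) \<Rightarrow> 'x measure \<Rightarrow> ('g \<Rightarrow> 'x \<Rightarrow> 'x) \<Rightarrow> ('x \<Rightarrow> complex) \<Rightarrow> 'x set" where
  "generic_set \<nu> F \<mu> T f = {x. generic_point \<nu> F \<mu> T (\<lambda>z. (cmod (f z))\<^sup>2) x}"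

definition mean_dist ::
    "'g measure \<Rightarrow> (nat \<Rightarrow> 'g set) \<Rightarrow> ('g \<Rightarrow> 'x \<Rightarrow> 'x) \<Rightarrow> ('x \<Rightarrow> complex) \<Rightarrow> 'x \<Rightarrow> 'x \<Rightarrow> ereal" where
  "mean_dist \<nu> F T f x y =
     limsup (\<lambda>n. ereal (sqrt
       ((LINT j:F n|\<nu>. (cmod (f (T j x) - f (T j y)))\<^sup>2) / measure \<nu> (F n))))"

definition mean_ball ::
    "'g measure \<Rightarrow> (nat \<Rightarrow> 'g set) \<Rightarrow> 'x measure \<Rightarrow> ('g \<Rightarrow> 'x \<Rightarrow> 'x) \<Rightarrow> ('x \<Rightarrow> complex) \<Rightarrow>
     real \<Rightarrow> 'x \<Rightarrow> 'x set" where
  "mean_ball \<nu> F \<mu> T f \<epsilon> x =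
     {y \<in> generic_set \<nu> F \<mu> T f. mean_dist \<nu> F T f x y \<le> ereal \<epsilon>}"

definition mean_sensitive ::
    "'g measure \<Rightarrow> (nat \<Rightarrow> 'g set) \<Rightarrow> 'x measure \<Rightarrow> ('g \<Rightarrow> 'x \<Rightarrow> 'x) \<Rightarrow> ('x \<Rightarrow> complex) \<Rightarrow> bool" where
  "mean_sensitive \<nu> F \<mu> T f \<longleftrightarrow>
     (\<exists>\<epsilon>>0. \<forall>A\<in>sets \<mu>. emeasure \<mu> A > 0 \<longrightarrow>
        (\<exists>x \<in> A \<inter> generic_set \<nu> F \<mu> T f. \<exists>y \<in> A \<inter> generic_set \<nu> F \<mu> T f.
           mean_dist \<nu> F T f x y > ereal \<epsilon>))"

definition mean_expansive ::
    "'g measure \<Rightarrow> (nat \<Rightarrow> 'g set) \<Rightarrow> 'x measure \<Rightarrow> ('g \<Rightarrow> 'x \<Rightarrow> 'x) \<Rightarrow> ('x \<Rightarrow> complex) \<Rightarrow> bool" where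
  "mean_expansive \<nu> F \<mu> T f \<longleftrightarrow>
     (\<exists>\<epsilon>>0. emeasure (\<mu> \<Otimes>\<^sub>M \<mu>)
        {(x, y). x \<in> generic_set \<nu> F \<mu> T f \<and> y \<in> generic_set \<nu> F \<mu> T f \<and>
                 mean_dist \<nu> F T f x y > ereal \<epsilon>} = 1)"

definition density_dist ::
    "'g measure \<Rightarrow> (nat \<Rightarrow> 'g set) \<Rightarrow> ('g \<Rightarrow> 'x \<Rightarrow> 'x) \<Rightarrow> ('x \<Rightarrow> complex) \<Rightarrow> 'x \<Rightarrow> 'x \<Rightarrow> real" where
  "density_dist \<nu> F T f x y =
     Inf {\<epsilon>. \<epsilon> > 0 \<and> upper_density \<nu> F {i. cmod (f (T i x) - f (T i y)) > \<epsilon>} < ereal \<epsilon>}"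

definition mean_equicontinuous ::
    "'g measure \<Rightarrow> (nat \<Rightarrow> 'g set) \<Rightarrow> 'x::metric_space measure \<Rightarrow> ('g \<Rightarrow> 'x \<Rightarrow> 'x) \<Rightarrow>
     ('x \<Rightarrow> complex) \<Rightarrow> bool" where
  "mean_equicontinuous \<nu> F \<mu> T f \<longleftrightarrow>
     (\<forall>\<tau>>0. \<exists>M. compact M \<and> measure \<mu> M \<ge> 1 - \<tau> \<and>
        (\<forall>\<epsilon>>0. \<exists>\<delta>>0. \<forall>x\<in>M. \<forall>y\<in>M. dist x y \<le> \<delta> \<longrightarrow> density_dist \<nu> F T f x y \<le> \<epsilon>))"

end

theory Submission
  imports Defs
begin

text \<open>
  The group being abelian, \<open>mean_dist\<close> is invariant under the diagonal action, so by ergodicity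
  the measure of the ball of radius \<open>e\<close> about \<open>x\<close> is almost surely either zero or at least some
  \<open>c > 0\<close>. If the first alternative holds for some \<open>e\<close>, Fubini's theorem gives expansivity and
  sensitivity. Otherwise the space is totally bounded for \<open>mean_dist\<close> up to null sets; finite
  partitions into pieces of small diameter, approximated from inside by compact sets, then yield
  mean equicontinuity. The distances \<open>mean_dist\<close> and \<open>density_dist\<close> are compared by Chebyshev's
  inequality in one direction and, in the other, by uniform integrability of \<open>|f|\<^sup>2\<close> along orbits
  of points that are generic for all truncations \<open>max 0 (|f|\<^sup>2 - N)\<close>.
\<close>

section \<open>Compact metric spaces as subspaces of sequence space\<close>

text \<open>Sensitivity, expansivity and failure of equicontinuity are each compared directly with
  condition (3), that almost every ball is null. Two obstacles shape the argument. As
  \<open>f\<close> is only square integrable, \<open>mean_dist\<close> is not visibly unchanged when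
  both points are moved by \<open>g\<close>: the part of \<open>F n\<close> that \<open>g\<close>
  pushes out has small relative measure, but |f|^2 may be large there, and genericity for |f|^2
  alone controls only the total average, not the tails. Moreover the group may be uncountable, so
  invariance is obtained for each \<open>g\<close> outside a null set depending on \<open>g\<close>;
  ergodicity is assumed in a form that tolerates this.\<close>

lemma compact_metric_embedding:
  assumes "compact (UNIV :: 'x::metric_space set)"
  obtains \<phi> :: "'x::metric_space \<Rightarrow> nat \<Rightarrow> real" and \<psi> where "homeomorphism UNIV (range \<phi>) \<phi> \<psi>"
proof -
  have "\<exists>k. finite k \<and> (UNIV :: 'x set) \<subseteq> (\<Union>x\<in>k. ball x (1 / Suc n))" for n
  proof -
    have "\<forall>e>0. \<exists>k. finite k \<and> (UNIV :: 'x set) \<subseteq> (\<Union>x\<in>k. ball x e)"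
      using assms unfolding compact_eq_totally_bounded by blast
    moreover have "0 < 1 / real (Suc n)"
      by simp
    ultimately show ?thesis
      by blast
  qed
  then obtain K where fin: "\<And>n. finite (K n)"
      and cov: "\<And>n. (UNIV :: 'x set) \<subseteq> (\<Union>x\<in>K n. ball x (1 / Suc n))"
    by metis
  define D where "D = (\<Union>n. K n)"
  have "countable D"
    unfolding D_def using fin by (auto intro: countable_finite)
  moreover have "K 0 \<noteq> {}"
    using cov[of 0] by auto
  then have "D \<noteq> {}"
    unfolding D_def by blast
  ultimately have range_d: "range (from_nat_into D) = D"
    by (rule range_from_nat_into[rotated])
  \<comment> \<open>Distances to a countable dense set: each coordinate is continuous, together they
    separate points, and compactness turns the continuous injection into a homeomorphism onto its
    image.\<close>
  define \<phi> :: "'x \<Rightarrow> nat \<Rightarrow> real" where "\<phi> x n = dist x (from_nat_into D n)" for x n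
  have "continuous_on UNIV \<phi>"
    unfolding \<phi>_def by (intro continuous_on_coordinatewise_then_product continuous_intros)
  moreover have "inj \<phi>"
  proof (rule injI, rule ccontr)
    fix x y assume eq: "\<phi> x = \<phi> y" and "x \<noteq> y"
    then have "0 < dist x y / 2"
      by simp
    then obtain n where n: "1 / Suc n < dist x y / 2"
      by (rule nat_approx_posE)
    obtain z where z: "z \<in> K n" "dist z x < 1 / Suc n"
      using subsetD[OF cov[of n] UNIV_I[of x]] by (auto simp: dist_commute)
    then have "z \<in> range (from_nat_into D)"
      unfolding range_d by (auto simp: D_def)
    then obtain m where "z = from_nat_into D m"
      by (rule rangeE)
    then have "dist x z = dist y z"
      using fun_cong[OF eq, of m] by (simp add: \<phi>_def)
    then show False
      using z n dist_triangle[of x y z] by (simp add: dist_commute)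
  qed
  ultimately show thesis
    using homeomorphism_compact[OF assms, of \<phi> "range \<phi>"] that by blast
qed

text \<open>The theorem \<open>inner_regular\<close> concerns complete second countable types,
  whereas here compactness is a hypothesis on \<open>'x\<close>. So the measure is pushed to
  \<open>nat \<Rightarrow> real\<close>, and the compact set found there is pulled back along the
  continuous inverse \<open>\<psi>\<close>.\<close>

lemma compact_inner_regular:
  fixes \<mu> :: "'x::metric_space measure"
  assumes cpt: "compact (UNIV :: 'x set)" and sets [measurable_cong]: "sets \<mu> = sets borel"
    and fin: "finite_measure \<mu>" and A: "A \<in> sets \<mu>" and e: "0 < e"
  obtains K where "compact K" "K \<subseteq> A" "measure \<mu> A - e \<le> measure \<mu> K"
proof -
  interpret finite_measure \<mu> by fact
  obtain \<phi> :: "'x \<Rightarrow> nat \<Rightarrow> real" and \<psi> where hom: "homeomorphism UNIV (range \<phi>) \<phi> \<psi>"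
    using compact_metric_embedding[OF cpt] .
  have cont: "continuous_on UNIV \<phi>" "continuous_on (range \<phi>) \<psi>" and inv: "\<And>x. \<psi> (\<phi> x) = x"
    using hom by (auto simp: homeomorphism_def)
  have [measurable]: "\<phi> \<in> borel_measurable \<mu>"
    using borel_measurable_continuous_onI[OF cont(1)] by (simp add: measurable_cong_sets[OF sets refl])
  have "compact (range \<phi>)"
    using cont(1) cpt compact_continuous_image by blast
  then have Z: "range \<phi> \<in> sets borel"
    by (intro borel_closed compact_imp_closed)
  \<comment> \<open>The image of \<open>A\<close> under \<open>\<phi>\<close> is Borel because it is
    also a preimage under \<open>\<psi>\<close>, which is continuous on a compact set.\<close>
  have "\<psi> -` A \<inter> space (restrict_space borel (range \<phi>)) \<in> sets (restrict_space borel (range \<phi>))"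
    using borel_measurable_continuous_on_restrict[OF cont(2)] A sets
    by (intro measurable_sets[where A=borel]) auto
  moreover have "\<psi> -` A \<inter> range \<phi> = \<phi> ` A"
    using inv by force
  ultimately have "\<phi> ` A \<in> sets borel"
    using Z by (auto simp: space_restrict_space sets_restrict_space_iff)
  interpret N: finite_measure "distr \<mu> borel \<phi>"
    by (rule finite_measure_distr) simp
  have "emeasure (distr \<mu> borel \<phi>) (\<phi> ` A) =
      (SUP K\<in>{K. K \<subseteq> \<phi> ` A \<and> compact K}. emeasure (distr \<mu> borel \<phi>) K)"
    using \<open>\<phi> ` A \<in> sets borel\<close> by (intro inner_regular) auto
  moreover have vim: "\<phi> -` \<phi> ` A \<inter> space \<mu> = A"
    using inv sets_eq_imp_space_eq[OF sets] by (auto dest!: arg_cong[where f=\<psi>])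
  ultimately have SUP: "emeasure \<mu> A =
      (SUP K\<in>{K. K \<subseteq> \<phi> ` A \<and> compact K}. emeasure (distr \<mu> borel \<phi>) K)"
    using \<open>\<phi> ` A \<in> sets borel\<close> by (simp add: emeasure_distr)
  show thesis
  \<comment> \<open>The case split keeps \<open>measure \<mu> A - e\<close> positive in the second
    case, where \<open>ennreal\<close> would otherwise cut it off at zero.\<close>
  proof (cases "measure \<mu> A \<le> e")
    case True
    then show thesis
      by (intro that[of "{}"]) auto
  next
    case False
    then have "ennreal (measure \<mu> A - e) < emeasure \<mu> A"
      using e by (simp add: emeasure_eq_measure ennreal_less_iff)
    then have "\<exists>K\<in>{K. K \<subseteq> \<phi> ` A \<and> compact K}.
        ennreal (measure \<mu> A - e) < emeasure (distr \<mu> borel \<phi>) K"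
      unfolding SUP less_SUP_iff .
    then obtain K where "K \<in> {K. K \<subseteq> \<phi> ` A \<and> compact K}"
        and less: "ennreal (measure \<mu> A - e) < emeasure (distr \<mu> borel \<phi>) K"
      by (rule bexE)
    then have K: "K \<subseteq> \<phi> ` A" "compact K"
      by simp_all
    have "\<psi> k \<in> space \<mu> \<and> \<phi> (\<psi> k) = k" if "k \<in> K" for k
      using that K(1) inv sets_eq_imp_space_eq[OF sets] by auto
    then have sub: "\<phi> -` K \<inter> space \<mu> = \<psi> ` K"
      by (auto intro: image_eqI[where x="\<phi> _"] simp: inv)
    have "K \<subseteq> range \<phi>"
      using K(1) by blast
    show thesis
    proof (rule that)
      show "compact (\<psi> ` K)"
        using K(2) \<open>K \<subseteq> range \<phi>\<close> cont(2)
        by (meson compact_continuous_image continuous_on_subset)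
      show "\<psi> ` K \<subseteq> A"
        using K(1) by (auto simp: inv dest!: subsetD)
      have "emeasure (distr \<mu> borel \<phi>) K = emeasure \<mu> (\<psi> ` K)"
        using K(2) by (simp add: emeasure_distr sub borel_compact)
      then show "measure \<mu> A - e \<le> measure \<mu> (\<psi> ` K)"
        using less False by (simp add: emeasure_eq_measure ennreal_less_iff)
    qed
  qed
qed

text \<open>
  The pointwise ergodic theorem is assumed for Borel subsets of \<^typ>\<open>nat \<Rightarrow> real\<close> only; a compact
  metric space embeds into the latter.
\<close>

lemma AE_generic_point:
  fixes \<mu> :: "'x::metric_space measure" and h :: "'x \<Rightarrow> real"
  assumes pet: "satisfies_pointwise_ergodic_theorem \<nu> F" and tds: "ergodic_TDS \<mu> T"
    and h: "integrable \<mu> h"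
  shows "AE x in \<mu>. generic_point \<nu> F \<mu> T h x"
proof -
  have cpt: "compact (UNIV :: 'x set)" and sets [measurable_cong]: "sets \<mu> = sets borel"
    and erg: "ergodic_action \<mu> T"
    using tds by (auto simp: ergodic_TDS_def)
  then have sp: "space \<mu> = UNIV"
    using sets_eq_imp_space_eq by fastforce
  interpret prob_space \<mu>
    using erg by (simp add: ergodic_action_def)
  have mpa: "measure_preserving_action \<mu> T"
    using erg by (simp add: ergodic_action_def)
  then have T [measurable]: "(\<lambda>(j, x). T j x) \<in> borel \<Otimes>\<^sub>M \<mu> \<rightarrow>\<^sub>M \<mu>"
    by (simp add: measure_preserving_action_def)
  have T1: "T j \<in> \<mu> \<rightarrow>\<^sub>M \<mu>" for j
    using T by measurable
  obtain \<phi> :: "'x \<Rightarrow> nat \<Rightarrow> real" and \<psi> where hom: "homeomorphism UNIV (range \<phi>) \<phi> \<psi>"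
    using compact_metric_embedding[OF cpt] .
  define Z where "Z = range \<phi>"
  have cont: "continuous_on UNIV \<phi>" "continuous_on Z \<psi>" and inv [simp]: "\<And>x. \<psi> (\<phi> x) = x"
    using hom by (auto simp: homeomorphism_def Z_def)
  have \<phi>Z [simp]: "\<phi> x \<in> Z" for x
    by (simp add: Z_def)
  have inv': "\<phi> (\<psi> z) = z" if "z \<in> Z" for z
    using that by (auto simp: Z_def)
  have "compact Z"
    unfolding Z_def using cont(1) cpt compact_continuous_image by blast
  then have Z: "Z \<in> sets borel"
    by (intro borel_closed compact_imp_closed)
  \<comment> \<open>The image measure lives on \<open>Z\<close> and not on the whole sequence space,
    because the conjugated maps \<open>S j\<close> form an action only where \<open>\<phi>\<close>
    inverts \<open>\<psi>\<close>.\<close>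
  define M where "M = distr \<mu> (restrict_space borel Z) \<phi>"
  have setsM: "sets M = sets (restrict_space borel Z)" and spM: "space M = Z"
    unfolding M_def by (auto simp: space_restrict_space)
  have "\<phi> \<in> borel_measurable \<mu>"
    using borel_measurable_continuous_onI[OF cont(1)] by (simp add: measurable_cong_sets[OF sets refl])
  then have \<phi>R: "\<phi> \<in> \<mu> \<rightarrow>\<^sub>M restrict_space borel Z"
    by (intro measurable_restrict_space2) (auto simp: Z_def)
  then have \<phi>M [measurable]: "\<phi> \<in> \<mu> \<rightarrow>\<^sub>M M"
    by (simp add: measurable_cong_sets[OF refl setsM])
  have "\<psi> \<in> borel_measurable (restrict_space borel Z)"
    using cont(2) by (rule borel_measurable_continuous_on_restrict)
  then have \<psi>M [measurable]: "\<psi> \<in> M \<rightarrow>\<^sub>M \<mu>"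
    by (simp add: measurable_cong_sets[OF setsM sets])
  have emM: "emeasure M A = emeasure \<mu> (\<phi> -` A)" if "A \<in> sets M" for A
    using that \<phi>R unfolding M_def by (simp add: emeasure_distr sp)
  define S where "S j z = \<phi> (T j (\<psi> z))" for j z
  have S_\<phi>: "S j (\<phi> x) = \<phi> (T j x)" for j x
    by (simp add: S_def)
  have prob: "prob_space M"
    unfolding M_def using \<phi>R by (rule prob_space_distr)
  have vim: "\<phi> -` (S j -` A \<inter> space M) = T j -` (\<phi> -` A) \<inter> space \<mu>" for j A
    by (auto simp: S_\<phi> spM sp)
  have vim_sets: "\<phi> -` A \<in> sets \<mu>" if "A \<in> sets M" for A
    using measurable_sets[OF \<phi>M that] sp by simp
  have S [measurable]: "(\<lambda>(j, z). S j z) \<in> borel \<Otimes>\<^sub>M M \<rightarrow>\<^sub>M M"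
    unfolding S_def by measurable
  then have S1: "S j \<in> M \<rightarrow>\<^sub>M M" for j
    by measurable
  have S_sets: "S j -` A \<inter> space M \<in> sets M" if "A \<in> sets M" for j A
    using measurable_sets[OF S1 that] .
  have mpaS: "measure_preserving_action M S"
    unfolding measure_preserving_action_def
  proof (intro conjI allI ballI)
    show "S 0 x = x" if "x \<in> space M" for x
      using that mpa by (simp add: S_def measure_preserving_action_def spM sp inv')
    show "S (i + j) x = S i (S j x)" if "x \<in> space M" for i j x
      using that mpa by (simp add: S_def measure_preserving_action_def spM sp)
    show "emeasure M (S j -` A \<inter> space M) = emeasure M A" if "A \<in> sets M" for j A
      unfolding emM[OF S_sets[OF that]] emM[OF that] vim
      using mpa vim_sets[OF that] by (simp add: measure_preserving_action_def)
  qed (rule S)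
  have "ergodic_action M S"
    unfolding ergodic_action_def
  proof (intro conjI ballI impI prob mpaS)
    fix A assume A: "A \<in> sets M"
      and 0: "\<forall>j. emeasure M (sym_diff (S j -` A \<inter> space M) A) = 0"
    have "emeasure \<mu> (sym_diff (T j -` (\<phi> -` A) \<inter> space \<mu>) (\<phi> -` A)) = 0" for j
    proof -
      have "sym_diff (T j -` (\<phi> -` A) \<inter> space \<mu>) (\<phi> -` A) =
          \<phi> -` sym_diff (S j -` A \<inter> space M) A"
        unfolding vim[symmetric] by auto
      then show ?thesis
        using 0 emM[of "sym_diff (S j -` A \<inter> space M) A"] A S_sets[OF A, of j] by auto
    qed
    then show "emeasure M A = 0 \<or> emeasure M A = 1"
      using erg vim_sets[OF A] A unfolding ergodic_action_def by (simp add: emM)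
  qed
  moreover have "standard_probability_space M"
    unfolding standard_probability_space_def using prob Z by (simp add: spM setsM)
  \<comment> \<open>The ergodic theorem is assumed for complex functions; the real statement is
    recovered at the end by taking real parts.\<close>
  moreover have "integrable M (\<lambda>z. complex_of_real (h (\<psi> z)))"
    unfolding M_def using h \<phi>R \<psi>M
    by (subst integrable_distr_eq)
      (auto simp: measurable_cong_sets[OF setsM refl, symmetric] complex_of_real_integrable_eq)
  ultimately have "AE z in M. generic_point \<nu> F M S (\<lambda>z. complex_of_real (h (\<psi> z))) z"
    using pet unfolding satisfies_pointwise_ergodic_theorem_def by blast
  then have "AE x in \<mu>. generic_point \<nu> F M S (\<lambda>z. complex_of_real (h (\<psi> z))) (\<phi> x)"
    unfolding M_def by (rule AE_distrD[OF \<phi>R])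
  moreover have "(\<integral>z. complex_of_real (h (\<psi> z)) \<partial>M) = complex_of_real (\<integral>x. h x \<partial>\<mu>)"
    unfolding M_def using h \<phi>R \<psi>M
    by (subst integral_distr) (auto simp: measurable_cong_sets[OF setsM refl, symmetric])
  moreover have "set_integrable \<nu> A g"
    if "set_integrable \<nu> A (\<lambda>j. complex_of_real (g j))" for A and g :: "_ \<Rightarrow> real"
    using integrable_Re[OF that[unfolded set_integrable_def]] by (simp add: set_integrable_def)
  ultimately show ?thesis
    by (elim AE_mp[OF _ AE_I2] impI)
      (auto simp: generic_point_def S_\<phi> set_integral_complex_of_real scaleR_conv_of_real
        simp flip: of_real_inverse of_real_mult dest: tendsto_Re)
qed

text \<open>Replaces Minkowski's inequality by something linear in squares. Nothing is lost for
  equal radii: two distances at most e still give 2 e, since 2 e^2 + 2 e^2 = (2 e)^2.\<close>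

lemma cmod_diff_square_le: "(cmod (a - b))\<^sup>2 \<le> 2 * (cmod a)\<^sup>2 + 2 * (cmod b)\<^sup>2"
proof -
  have "(cmod (a - b))\<^sup>2 \<le> (cmod a + cmod b)\<^sup>2"
    by (intro power_mono norm_triangle_ineq4) simp
  also have "\<dots> \<le> 2 * (cmod a)\<^sup>2 + 2 * (cmod b)\<^sup>2"
    using sum_squares_bound[of "cmod a" "cmod b"] by (simp add: power2_sum)
  finally show ?thesis .
qed

section \<open>Averages along the Folner sequence\<close>

locale folner_TDS =
  fixes \<nu> :: "'g::topological_ab_group_add measure"
    and F :: "nat \<Rightarrow> 'g set"
    and \<mu> :: "'x::metric_space measure"
    and T :: "'g \<Rightarrow> 'x \<Rightarrow> 'x"
    and f :: "'x \<Rightarrow> complex"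
  assumes haar: "haar_measure \<nu>"
    and folner: "folner_sequence \<nu> F"
    and pointwise_ergodic: "satisfies_pointwise_ergodic_theorem \<nu> F"
    and tds: "ergodic_TDS \<mu> T"
    and sq_int: "square_integrable \<mu> f"
begin

lemma sets_\<nu> [measurable_cong, simp]: "sets \<nu> = sets borel"
  using haar by (simp add: haar_measure_def)

lemma space_\<nu> [simp]: "space \<nu> = UNIV"
  using sets_eq_imp_space_eq[OF sets_\<nu>] by simp

lemma F_measurable [measurable]: "F n \<in> sets borel"
  using folner by (simp add: folner_sequence_def)

lemma F_emeasure: "emeasure \<nu> (F n) \<noteq> 0" "emeasure \<nu> (F n) \<noteq> \<infinity>"
  using folner by (simp_all add: folner_sequence_def zero_less_iff_neq_zero less_top)

lemma F_measure_pos: "0 < measure \<nu> (F n)"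
  using F_emeasure[of n] by (simp add: measure_def enn2real_positive_iff zero_less_iff_neq_zero less_top)

lemma compact_UNIV: "compact (UNIV :: 'x set)"
  using tds by (simp add: ergodic_TDS_def)

lemma sets_\<mu> [measurable_cong, simp]: "sets \<mu> = sets borel"
  using tds by (simp add: ergodic_TDS_def)

lemma space_\<mu> [simp]: "space \<mu> = UNIV"
  using sets_eq_imp_space_eq[OF sets_\<mu>] by simp

sublocale prob_space \<mu>
  using tds by (simp add: ergodic_TDS_def ergodic_action_def)

sublocale pair: pair_sigma_finite \<mu> \<mu> ..

lemma action: "measure_preserving_action \<mu> T"
  using tds by (simp add: ergodic_TDS_def ergodic_action_def)

lemma T_measurable [measurable]: "(\<lambda>(j, x). T j x) \<in> borel \<Otimes>\<^sub>M \<mu> \<rightarrow>\<^sub>M \<mu>"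
  using action by (simp add: measure_preserving_action_def)

lemma T_measurable_orbit [measurable]: "(\<lambda>j. T j x) \<in> borel \<rightarrow>\<^sub>M \<mu>"
  using measurable_compose[OF measurable_Pair2'[of x \<mu> borel] T_measurable] by simp

lemma T_measurable_map [measurable]: "T j \<in> \<mu> \<rightarrow>\<^sub>M \<mu>"
  using measurable_compose[OF measurable_Pair1'[of j borel \<mu>] T_measurable] by simp

lemma T_zero: "T 0 x = x" and T_add: "T (i + j) x = T i (T j x)"
  using action by (simp_all add: measure_preserving_action_def)

lemma T_preserves: "A \<in> sets \<mu> \<Longrightarrow> measure \<mu> (T j -` A) = measure \<mu> A"
  using action by (simp add: measure_preserving_action_def measure_def)

lemma distr_T: "distr \<mu> \<mu> (T j) = \<mu>"
  using action by (intro measure_eqI) (simp_all add: emeasure_distr measure_preserving_action_def)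

lemma AE_T: "AE x in \<mu>. Q x \<Longrightarrow> AE x in \<mu>. Q (T j x)"
  by (rule AE_distrD[OF T_measurable_map]) (simp only: distr_T)

lemma f_measurable [measurable]: "f \<in> borel_measurable \<mu>"
  using sq_int by (simp add: square_integrable_def)

lemma f_sq_integrable: "integrable \<mu> (\<lambda>x. (cmod (f x))\<^sup>2)"
  using sq_int by (simp add: square_integrable_def)

text \<open>Normalised restriction of the Haar measure: averages over \<open>F n\<close> become
  expectations, and the inequalities for probability measures apply.\<close>

definition P :: "nat \<Rightarrow> 'g measure" where
  "P n = uniform_measure \<nu> (F n)"

lemma sets_P [measurable_cong, simp]: "sets (P n) = sets borel" and space_P [simp]: "space (P n) = UNIV"
  by (simp_all add: P_def)

lemma prob_space_P: "prob_space (P n)"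
  unfolding P_def by (intro prob_space_uniform_measure F_emeasure)

lemma measure_P: "A \<in> sets borel \<Longrightarrow> measure (P n) A = measure \<nu> (A \<inter> F n) / measure \<nu> (F n)"
  unfolding P_def using F_emeasure by (simp add: Int_commute)

lemma P_density: "P n = density \<nu> (\<lambda>x. ennreal (indicator (F n) x / measure \<nu> (F n)))"
proof -
  have "indicator (F n) x / emeasure \<nu> (F n) = ennreal (indicator (F n) x / measure \<nu> (F n))" for x
    using F_emeasure F_measure_pos
    by (auto simp: emeasure_eq_ennreal_measure divide_ennreal indicator_def
        simp flip: ennreal_1)
  then show ?thesis
    by (simp add: P_def uniform_measure_def)
qed

lemma integrable_P:
  fixes h :: "'g \<Rightarrow> real"
  assumes [measurable]: "h \<in> borel_measurable borel"
  shows "integrable (P n) h \<longleftrightarrow> set_integrable \<nu> (F n) h"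
proof -
  have "integrable (P n) h \<longleftrightarrow> integrable \<nu> (\<lambda>x. (1 / measure \<nu> (F n)) * (indicator (F n) x * h x))"
    unfolding P_density using F_measure_pos by (subst integrable_density) (auto simp: ac_simps)
  also have "\<dots> \<longleftrightarrow> integrable \<nu> (\<lambda>x. indicator (F n) x * h x)"
    using F_measure_pos[of n] by (subst integrable_mult_left_iff) auto
  finally show ?thesis
    by (simp add: set_integrable_def)
qed

lemma integral_P:
  fixes h :: "'g \<Rightarrow> real"
  assumes [measurable]: "h \<in> borel_measurable borel"
  shows "(\<integral>j. h j \<partial>P n) = (LINT j:F n|\<nu>. h j) / measure \<nu> (F n)"
proof -
  have "(\<integral>j. h j \<partial>P n) = (\<integral>x. (1 / measure \<nu> (F n)) * (indicator (F n) x * h x) \<partial>\<nu>)"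
    unfolding P_density using F_measure_pos by (subst integral_density) (auto simp: ac_simps)
  then show ?thesis
    by (simp add: set_lebesgue_integral_def)
qed

lemma generic_point_iff:
  fixes h :: "'x \<Rightarrow> real"
  assumes [measurable]: "h \<in> borel_measurable \<mu>"
  shows "generic_point \<nu> F \<mu> T h x \<longleftrightarrow>
    (\<forall>n. integrable (P n) (\<lambda>j. h (T j x))) \<and> (\<lambda>n. \<integral>j. h (T j x) \<partial>P n) \<longlonglongrightarrow> (\<integral>z. h z \<partial>\<mu>)"
  unfolding generic_point_def by (simp add: integrable_P integral_P divide_inverse ac_simps)

section \<open>The mean distance and its measurability\<close>

definition sq_diff :: "nat \<Rightarrow> 'x \<Rightarrow> 'x \<Rightarrow> real" where
  "sq_diff n x y = (\<integral>j. (cmod (f (T j x) - f (T j y)))\<^sup>2 \<partial>P n)"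

abbreviation "G \<equiv> generic_set \<nu> F \<mu> T f"
abbreviation "df \<equiv> mean_dist \<nu> F T f"
abbreviation "Bf \<equiv> mean_ball \<nu> F \<mu> T f"

lemma mean_dist_eq: "df x y = limsup (\<lambda>n. ereal (sqrt (sq_diff n x y)))"
  unfolding mean_dist_def sq_diff_def by (subst integral_P) simp_all

lemma sq_diff_commute: "sq_diff n x y = sq_diff n y x"
  by (simp add: sq_diff_def norm_minus_commute)

lemma mean_dist_commute: "df x y = df y x"
  by (simp add: mean_dist_eq sq_diff_commute)

text \<open>Removes limsup, roots and extended reals: later estimates are eventual bounds on
  \<open>sq_diff\<close>. The strict \<open>r > e\<close> is what a bound on a limsup
  yields.\<close>

lemma mean_dist_le_iff:
  assumes "0 \<le> e"
  shows "df x y \<le> ereal e \<longleftrightarrow> (\<forall>r>e. \<forall>\<^sub>F n in sequentially. sq_diff n x y < r\<^sup>2)"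
proof -
  have *: "ereal (sqrt a) < ereal r \<longleftrightarrow> a < r\<^sup>2" if "e < r" for a r
    using that assms real_sqrt_less_iff[of a "r\<^sup>2"] by simp
  have "df x y \<le> ereal e \<longleftrightarrow>
      (\<forall>r>ereal e. \<forall>\<^sub>F n in sequentially. ereal (sqrt (sq_diff n x y)) < r)"
    unfolding mean_dist_eq by (rule Limsup_le_iff)
  also have "\<dots> \<longleftrightarrow> (\<forall>r>e. \<forall>\<^sub>F n in sequentially. ereal (sqrt (sq_diff n x y)) < ereal r)"
  proof (intro iffI allI impI)
    fix r :: ereal
    assume *: "\<forall>r>e. \<forall>\<^sub>F n in sequentially. ereal (sqrt (sq_diff n x y)) < ereal r" and "ereal e < r"
    then show "\<forall>\<^sub>F n in sequentially. ereal (sqrt (sq_diff n x y)) < r"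
      by (cases r) auto
  next
    fix r :: real
    assume "\<forall>r>ereal e. \<forall>\<^sub>F n in sequentially. ereal (sqrt (sq_diff n x y)) < r" and "e < r"
    then show "\<forall>\<^sub>F n in sequentially. ereal (sqrt (sq_diff n x y)) < ereal r"
      by (elim allE[of _ "ereal r"]) simp
  qed
  also have "\<dots> \<longleftrightarrow> (\<forall>r>e. \<forall>\<^sub>F n in sequentially. sq_diff n x y < r\<^sup>2)"
    using * by auto
  finally show ?thesis .
qed

lemma sigma_finite_P: "sigma_finite_measure (P n)"
  using prob_space_P prob_space_imp_sigma_finite by blast

text \<open>The action is jointly measurable, so the integrand is measurable in both points and the
  group variable together; integrating out the latter against a sigma-finite measure preserves
  this.\<close>

lemma sq_diff_measurable [measurable]: "case_prod (sq_diff n) \<in> borel_measurable (\<mu> \<Otimes>\<^sub>M \<mu>)"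
proof -
  interpret P: sigma_finite_measure "P n"
    by (rule sigma_finite_P)
  have [measurable]: "(\<lambda>w. T (snd w) (fst (fst w))) \<in> (\<mu> \<Otimes>\<^sub>M \<mu>) \<Otimes>\<^sub>M P n \<rightarrow>\<^sub>M \<mu>"
      "(\<lambda>w. T (snd w) (snd (fst w))) \<in> (\<mu> \<Otimes>\<^sub>M \<mu>) \<Otimes>\<^sub>M P n \<rightarrow>\<^sub>M \<mu>"
    using measurable_compose[OF _ T_measurable, of "\<lambda>w. (snd w, fst (fst w))" "(\<mu> \<Otimes>\<^sub>M \<mu>) \<Otimes>\<^sub>M P n"]
      measurable_compose[OF _ T_measurable, of "\<lambda>w. (snd w, snd (fst w))" "(\<mu> \<Otimes>\<^sub>M \<mu>) \<Otimes>\<^sub>M P n"]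
    by simp_all
  show ?thesis
    unfolding sq_diff_def case_prod_beta
    by (rule P.borel_measurable_lebesgue_integral) (simp add: case_prod_beta)
qed

lemma mean_dist_measurable [measurable]: "case_prod df \<in> borel_measurable (\<mu> \<Otimes>\<^sub>M \<mu>)"
proof -
  have "(\<lambda>p. limsup (\<lambda>n. ereal (sqrt (case_prod (sq_diff n) p)))) \<in> borel_measurable (\<mu> \<Otimes>\<^sub>M \<mu>)"
    by measurable
  also have "(\<lambda>p. limsup (\<lambda>n. ereal (sqrt (case_prod (sq_diff n) p)))) = case_prod df"
    by (auto simp: mean_dist_eq)
  finally show ?thesis .
qed

lemma generic_set_measurable [measurable]: "G \<in> sets \<mu>"
proof -
  let ?h = "\<lambda>z. (cmod (f z))\<^sup>2" and ?A = "\<lambda>n x. \<integral>j. (cmod (f (T j x)))\<^sup>2 \<partial>P n"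
  have [measurable]: "(\<lambda>(x, j). (cmod (f (T j x)))\<^sup>2) \<in> borel_measurable (\<mu> \<Otimes>\<^sub>M P n)" for n
    using measurable_compose[OF _ T_measurable, of "\<lambda>w. (snd w, fst w)" "\<mu> \<Otimes>\<^sub>M P n"]
    by (simp add: case_prod_beta)
  have [measurable]: "?A n \<in> borel_measurable \<mu>" for n
    by (rule sigma_finite_measure.borel_measurable_lebesgue_integral[OF sigma_finite_P]) simp
  have [measurable]: "Measurable.pred \<mu> (\<lambda>x. integrable (P n) (\<lambda>j. (cmod (f (T j x)))\<^sup>2))" for n
    by (rule sigma_finite_measure.borel_measurable_lebesgue_integrable[OF sigma_finite_P]) simp
  \<comment> \<open>Convergence to a fixed number is rewritten by \<open>liminf\<close> and
    \<open>limsup\<close>, which are measurable as countable operations.\<close>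
  have lim: "(\<lambda>n. ?A n x) \<longlonglongrightarrow> c \<longleftrightarrow>
      liminf (\<lambda>n. ereal (?A n x)) = ereal c \<and> limsup (\<lambda>n. ereal (?A n x)) = ereal c" for x c
    unfolding lim_ereal[symmetric]
    using tendsto_iff_Liminf_eq_Limsup[OF sequentially_bot, of "\<lambda>n. ereal (?A n x)" "ereal c"]
    by simp
  have "G = {x\<in>space \<mu>. (\<forall>n. integrable (P n) (\<lambda>j. ?h (T j x))) \<and>
      liminf (\<lambda>n. ereal (?A n x)) = ereal (\<integral>z. ?h z \<partial>\<mu>) \<and>
      limsup (\<lambda>n. ereal (?A n x)) = ereal (\<integral>z. ?h z \<partial>\<mu>)}"
    by (simp add: generic_set_def generic_point_iff lim)
  also have "\<dots> \<in> sets \<mu>"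
    by measurable
  finally show ?thesis .
qed

lemma mean_ball_rel_measurable: "{(x, y). y \<in> G \<and> df x y \<le> ereal e} \<in> sets (\<mu> \<Otimes>\<^sub>M \<mu>)"
proof -
  have "{p\<in>space (\<mu> \<Otimes>\<^sub>M \<mu>). snd p \<in> G \<and> case_prod df p \<le> ereal e} \<in> sets (\<mu> \<Otimes>\<^sub>M \<mu>)"
    by measurable
  also have "{p\<in>space (\<mu> \<Otimes>\<^sub>M \<mu>). snd p \<in> G \<and> case_prod df p \<le> ereal e} =
      {(x, y). y \<in> G \<and> df x y \<le> ereal e}"
    by (auto simp: space_pair_measure)
  finally show ?thesis .
qed

text \<open>Balls are sections of a single product-measurable set, whence their measure depends
  measurably on the centre.\<close>

lemma mean_ball_eq: "Bf e x = Pair x -` {(x, y). y \<in> G \<and> df x y \<le> ereal e}"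
  by (auto simp: mean_ball_def)

lemma mean_ball_measurable [measurable]: "Bf e x \<in> sets \<mu>"
  unfolding mean_ball_eq by (rule sets_Pair1[OF mean_ball_rel_measurable])

lemma measure_mean_ball_measurable [measurable]: "(\<lambda>x. measure \<mu> (Bf e x)) \<in> borel_measurable \<mu>"
  unfolding mean_ball_eq measure_def
  by (intro borel_measurable_enn2real measurable_emeasure_Pair mean_ball_rel_measurable)

section \<open>Generic points and a weak triangle inequality\<close>

text \<open>The truncation at \<open>N = 0\<close> is |f|^2 itself, so these points lie in
  \<open>G\<close>; larger \<open>N\<close> control the tails. Only countably many functions occur,
  which keeps the measure full.\<close>

definition good :: "'x set" where
  "good = {x. \<forall>N::nat. generic_point \<nu> F \<mu> T (\<lambda>z. max 0 ((cmod (f z))\<^sup>2 - real N)) x}"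

lemma AE_good: "AE x in \<mu>. x \<in> good"
proof -
  have "integrable \<mu> (\<lambda>z. max 0 ((cmod (f z))\<^sup>2 - real N))" for N
    using f_sq_integrable by (intro integrable_max Bochner_Integration.integrable_diff) auto
  then show ?thesis
    unfolding good_def
    by (simp add: AE_all_countable AE_generic_point[OF pointwise_ergodic tds])
qed

lemma good_generic: "x \<in> good \<Longrightarrow> x \<in> G"
  unfolding good_def generic_set_def by (auto dest: spec[of _ 0])

lemma AE_generic: "AE x in \<mu>. x \<in> G"
  using AE_good by eventually_elim (rule good_generic)

lemma integrable_orbit_sq: "x \<in> G \<Longrightarrow> integrable (P n) (\<lambda>j. (cmod (f (T j x)))\<^sup>2)"
  by (simp add: generic_set_def generic_point_iff)

lemma integrable_orbit_diff:
  assumes "x \<in> G" "y \<in> G"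
  shows "integrable (P n) (\<lambda>j. (cmod (f (T j x) - f (T j y)))\<^sup>2)"
proof (rule Bochner_Integration.integrable_bound)
  show "integrable (P n) (\<lambda>j. 2 * (cmod (f (T j x)))\<^sup>2 + 2 * (cmod (f (T j y)))\<^sup>2)"
    using assms by (intro Bochner_Integration.integrable_add integrable_mult_right)
      (auto intro: integrable_orbit_sq)
qed (auto simp: cmod_diff_square_le)

text \<open>Genericity of all three points makes the integrands integrable; a non-integrable one
  would have integral 0 by convention and could break the comparison.\<close>

lemma mean_dist_double:
  assumes "x \<in> G" "y \<in> G" "z \<in> G" "0 \<le> e" "df x y \<le> ereal e" "df x z \<le> ereal e"
  shows "df y z \<le> ereal (2 * e)"
proof -
  have le: "sq_diff n y z \<le> 2 * sq_diff n x y + 2 * sq_diff n x z" for n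
  proof -
    have "(cmod (f (T j y) - f (T j z)))\<^sup>2 \<le>
        2 * (cmod (f (T j x) - f (T j y)))\<^sup>2 + 2 * (cmod (f (T j x) - f (T j z)))\<^sup>2" for j
      using cmod_diff_square_le[of "f (T j x) - f (T j z)" "f (T j x) - f (T j y)"]
      by simp
    then have "sq_diff n y z \<le> (\<integral>j. 2 * (cmod (f (T j x) - f (T j y)))\<^sup>2 +
        2 * (cmod (f (T j x) - f (T j z)))\<^sup>2 \<partial>P n)"
      unfolding sq_diff_def using assms by (intro integral_mono) (auto intro!: integrable_orbit_diff)
    also have "\<dots> = 2 * sq_diff n x y + 2 * sq_diff n x z"
      unfolding sq_diff_def using assms
      by (subst Bochner_Integration.integral_add) (auto intro!: integrable_orbit_diff)
    finally show ?thesis .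
  qed
  have "\<forall>\<^sub>F n in sequentially. sq_diff n y z < r\<^sup>2" if "2 * e < r" for r
  proof -
    \<comment> \<open>As \<open>r / 2 > e\<close>, both averages fall below
      \<open>(r / 2)\<^sup>2\<close>, and twice their sum is then below
      \<open>r\<^sup>2\<close>.\<close>
    have "\<forall>\<^sub>F n in sequentially. sq_diff n x y < (r / 2)\<^sup>2"
        "\<forall>\<^sub>F n in sequentially. sq_diff n x z < (r / 2)\<^sup>2"
      using assms(4-6) that by (auto simp: mean_dist_le_iff)
    then show ?thesis
    proof eventually_elim
      case (elim n)
      then show ?case
        using le[of n] by (simp add: power_divide)
    qed
  qed
  then show ?thesis
    using assms(4) by (simp add: mean_dist_le_iff)
qed

section \<open>Uniform integrability along orbits\<close>

text \<open>On \<open>E\<close>, |f|^2 is at most \<open>N\<close> plus its excess over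
  \<open>N\<close>. The first part contributes at most \<open>N\<close> times the measure of
  \<open>E\<close>; the orbit average of the excess tends to its integral, which is small for large
  \<open>N\<close>. Thus \<open>\<delta>\<close> does not depend on \<open>x\<close>, only the index
  from which on the bound holds does.\<close>

lemma uniform_integrability:
  assumes "0 < \<kappa>"
  shows "\<exists>\<delta>>0. \<forall>x\<in>good. \<forall>\<^sub>F n in sequentially. \<forall>E\<in>sets borel. measure (P n) E \<le> \<delta> \<longrightarrow>
    (\<integral>j. indicator E j * (cmod (f (T j x)))\<^sup>2 \<partial>P n) \<le> \<kappa>"
proof -
  define t where "t N z = max 0 ((cmod (f z))\<^sup>2 - real N)" for N z
  have t_measurable [measurable]: "t N \<in> borel_measurable \<mu>" for N
    unfolding t_def by measurable
  have "(\<lambda>N. \<integral>z. t N z \<partial>\<mu>) \<longlonglongrightarrow> (\<integral>z. 0 \<partial>\<mu>)"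
  proof (rule integral_dominated_convergence[OF _ _ f_sq_integrable])
    have "(\<lambda>N. t N z) \<longlonglongrightarrow> 0" for z
    proof (rule tendsto_eventually)
      show "\<forall>\<^sub>F N in sequentially. t N z = 0"
        using eventually_ge_at_top[of "nat \<lceil>(cmod (f z))\<^sup>2\<rceil>"]
        by eventually_elim (simp add: t_def nat_ceiling_le_eq)
    qed
    then show "AE z in \<mu>. (\<lambda>N. t N z) \<longlonglongrightarrow> 0"
      by simp
  qed (auto simp: t_def)
  then have "(\<lambda>N. \<integral>z. t N z \<partial>\<mu>) \<longlonglongrightarrow> 0"
    by simp
  then have "\<forall>\<^sub>F N in sequentially. (\<integral>z. t N z \<partial>\<mu>) < \<kappa> / 2"
    using assms by (intro order_tendstoD(2)) auto
  then obtain N where N: "(\<integral>z. t N z \<partial>\<mu>) < \<kappa> / 2"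
    by (auto simp: eventually_sequentially)
  define \<delta> where "\<delta> = \<kappa> / (2 * (real N + 1))"
  have "0 < \<delta>"
    using assms by (simp add: \<delta>_def)
  moreover have "\<forall>\<^sub>F n in sequentially. \<forall>E\<in>sets borel. measure (P n) E \<le> \<delta> \<longrightarrow>
      (\<integral>j. indicator E j * (cmod (f (T j x)))\<^sup>2 \<partial>P n) \<le> \<kappa>" if "x \<in> good" for x
  proof -
    have gen: "generic_point \<nu> F \<mu> T (t N) x"
      using that unfolding good_def t_def by simp
    then have int: "integrable (P n) (\<lambda>j. t N (T j x))" for n
      by (simp add: generic_point_iff)
    have "\<forall>\<^sub>F n in sequentially. (\<integral>j. t N (T j x) \<partial>P n) < \<kappa> / 2"
      using gen N by (intro order_tendstoD(2)) (auto simp: generic_point_iff)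
    then show ?thesis
    proof (eventually_elim, intro ballI impI)
      fix n E
      assume A: "(\<integral>j. t N (T j x) \<partial>P n) < \<kappa> / 2" and E [measurable]: "E \<in> sets borel"
        and le: "measure (P n) E \<le> \<delta>"
      interpret P: prob_space "P n"
        by (rule prob_space_P)
      have "(\<integral>j. indicator E j * (cmod (f (T j x)))\<^sup>2 \<partial>P n)
          \<le> (\<integral>j. real N * indicator E j + t N (T j x) \<partial>P n)"
      proof (rule integral_mono')
        show "integrable (P n) (\<lambda>j. real N * indicator E j + t N (T j x))"
          by (intro Bochner_Integration.integrable_add int integrable_mult_right)
            (simp add: P.emeasure_eq_measure)
      qed (auto simp: t_def indicator_def)
      also have "\<dots> = real N * measure (P n) E + (\<integral>j. t N (T j x) \<partial>P n)"
        by (subst Bochner_Integration.integral_add)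
          (auto intro!: int integrable_mult_right simp: P.emeasure_eq_measure)
      also have "\<dots> \<le> real N * \<delta> + \<kappa> / 2"
        using A le by (intro add_mono mult_left_mono) auto
      also have "\<dots> \<le> (real N + 1) * \<delta> + \<kappa> / 2"
        using \<open>0 < \<delta>\<close> by (simp add: algebra_simps)
      also have "\<dots> = \<kappa>"
        by (simp add: \<delta>_def add_nonneg_eq_0_iff field_simps)
      finally show "(\<integral>j. indicator E j * (cmod (f (T j x)))\<^sup>2 \<partial>P n) \<le> \<kappa>" .
    qed
  qed
  ultimately show ?thesis
    by blast
qed

lemma indicator_sq_diff_le:
  assumes "x \<in> G" "y \<in> G" and [measurable]: "E \<in> sets borel"
  shows "(\<integral>j. indicator E j * (cmod (f (T j x) - f (T j y)))\<^sup>2 \<partial>P n) \<le>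
    2 * (\<integral>j. indicator E j * (cmod (f (T j x)))\<^sup>2 \<partial>P n) +
    2 * (\<integral>j. indicator E j * (cmod (f (T j y)))\<^sup>2 \<partial>P n)"
proof -
  have int: "integrable (P n) (\<lambda>j. indicator E j * (cmod (f (T j z)))\<^sup>2)" if "z \<in> G" for z
    using integrable_mult_indicator[OF _ integrable_orbit_sq[OF that]] by simp
  have "(\<integral>j. indicator E j * (cmod (f (T j x) - f (T j y)))\<^sup>2 \<partial>P n) \<le>
      (\<integral>j. 2 * (indicator E j * (cmod (f (T j x)))\<^sup>2) + 2 * (indicator E j * (cmod (f (T j y)))\<^sup>2) \<partial>P n)"
    using int[OF assms(1)] int[OF assms(2)]
    by (intro integral_mono') (auto simp: indicator_def cmod_diff_square_le)
  also have "\<dots> = 2 * (\<integral>j. indicator E j * (cmod (f (T j x)))\<^sup>2 \<partial>P n) +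
      2 * (\<integral>j. indicator E j * (cmod (f (T j y)))\<^sup>2 \<partial>P n)"
    using int[OF assms(1)] int[OF assms(2)] by simp
  finally show ?thesis .
qed

lemma uniform_integrability_diff:
  assumes "0 < \<kappa>"
  shows "\<exists>\<delta>>0. \<forall>x\<in>good. \<forall>y\<in>good.
    \<forall>\<^sub>F n in sequentially. \<forall>E\<in>sets borel. measure (P n) E \<le> \<delta> \<longrightarrow>
      (\<integral>j. indicator E j * (cmod (f (T j x) - f (T j y)))\<^sup>2 \<partial>P n) \<le> \<kappa>"
proof -
  \<comment> \<open>A quarter each, because \<open>indicator_sq_diff_le\<close> doubles the
    contributions of both points.\<close>
  have "0 < \<kappa> / 4"
    using assms by simp
  then obtain \<delta> where "0 < \<delta>" and
    \<delta>: "\<forall>x\<in>good. \<forall>\<^sub>F n in sequentially. \<forall>E\<in>sets borel. measure (P n) E \<le> \<delta> \<longrightarrow>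
      (\<integral>j. indicator E j * (cmod (f (T j x)))\<^sup>2 \<partial>P n) \<le> \<kappa> / 4"
    using uniform_integrability[of "\<kappa> / 4"] by blast
  have "\<forall>\<^sub>F n in sequentially. \<forall>E\<in>sets borel. measure (P n) E \<le> \<delta> \<longrightarrow>
      (\<integral>j. indicator E j * (cmod (f (T j x) - f (T j y)))\<^sup>2 \<partial>P n) \<le> \<kappa>"
    if "x \<in> good" "y \<in> good" for x y
    using bspec[OF \<delta> that(1)] bspec[OF \<delta> that(2)]
  proof (eventually_elim, intro ballI impI)
    fix n E
    assume small: "\<forall>E\<in>sets borel. measure (P n) E \<le> \<delta> \<longrightarrow>
        (\<integral>j. indicator E j * (cmod (f (T j x)))\<^sup>2 \<partial>P n) \<le> \<kappa> / 4"
      "\<forall>E\<in>sets borel. measure (P n) E \<le> \<delta> \<longrightarrow>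
        (\<integral>j. indicator E j * (cmod (f (T j y)))\<^sup>2 \<partial>P n) \<le> \<kappa> / 4"
      and E: "E \<in> sets borel" and "measure (P n) E \<le> \<delta>"
    then have "(\<integral>j. indicator E j * (cmod (f (T j x)))\<^sup>2 \<partial>P n) \<le> \<kappa> / 4"
        "(\<integral>j. indicator E j * (cmod (f (T j y)))\<^sup>2 \<partial>P n) \<le> \<kappa> / 4"
      by blast+
    then show "(\<integral>j. indicator E j * (cmod (f (T j x) - f (T j y)))\<^sup>2 \<partial>P n) \<le> \<kappa>"
      using indicator_sq_diff_le[OF good_generic[OF that(1)] good_generic[OF that(2)] E, of n]
      by linarith
  qed
  with \<open>0 < \<delta>\<close> show ?thesis
    by blast
qed

section \<open>Invariance and ergodicity\<close>

lemma add_right_measurable [measurable]: "(\<lambda>j::'g. j + g) \<in> borel \<rightarrow>\<^sub>M borel"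
  by (intro borel_measurable_continuous_onI continuous_intros)

lemma haar_translate: "A \<in> sets borel \<Longrightarrow> emeasure \<nu> ((\<lambda>h. g + h) ` A) = emeasure \<nu> A"
  using haar unfolding haar_measure_def by blast

lemma distr_add: "distr \<nu> borel (\<lambda>j. j + g) = \<nu>"
proof (rule measure_eqI)
  fix A assume "A \<in> sets (distr \<nu> borel (\<lambda>j. j + g))"
  then have A [measurable]: "A \<in> sets borel"
    by simp
  have "(\<lambda>j. j + g) -` A = (\<lambda>h. - g + h) ` A"
    by (force simp: image_iff intro: bexI[where x="_ + g"])
  then show "emeasure (distr \<nu> borel (\<lambda>j. j + g)) A = emeasure \<nu> A"
    using haar_translate[OF A, of "- g"] by (simp add: emeasure_distr)
qed simp

text \<open>A point of \<open>F n\<close> that \<open>g\<close> carries out of \<open>F n\<close> is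
  not in the translate of \<open>F n\<close> by \<open>- g\<close>, hence lies in the symmetric
  difference of the Folner condition for \<open>- g\<close>.\<close>

lemma folner_escape:
  "(\<lambda>n. measure (P n) {j. j + g \<notin> F n}) \<longlonglongrightarrow> 0"
proof (rule tendsto_sandwich[OF always_eventually always_eventually tendsto_const])
  let ?S = "\<lambda>n. sym_diff ((\<lambda>h. - g + h) ` F n) (F n)"
  show "(\<lambda>n. measure \<nu> (?S n) / measure \<nu> (F n)) \<longlonglongrightarrow> 0"
    using folner unfolding folner_sequence_def by blast
  show "\<forall>n. measure (P n) {j. j + g \<notin> F n} \<le> measure \<nu> (?S n) / measure \<nu> (F n)"
  proof
    fix n
    have im: "(\<lambda>h. - g + h) ` F n = (\<lambda>j. j + g) -` F n"
      by (force simp: image_iff intro: bexI[where x="_ + g"])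
    have "(\<lambda>j. j + g) -` F n \<in> sets borel"
      using measurable_sets[OF add_right_measurable F_measurable, of g n] by simp
    moreover have "emeasure \<nu> ((\<lambda>j. j + g) -` F n) = emeasure \<nu> (F n)"
      unfolding im[symmetric] by (rule haar_translate) simp
    \<comment> \<open>Finiteness has to be secured before comparing: \<open>measure\<close> is 0 on
      sets of infinite measure and so is not monotone in general.\<close>
    ultimately have "?S n \<in> fmeasurable \<nu>"
      unfolding im using F_emeasure[of n]
      by (intro fmeasurable.Un fmeasurable_Diff fmeasurableI) (auto simp: less_top)
    then have "measure \<nu> ({j. j + g \<notin> F n} \<inter> F n) \<le> measure \<nu> (?S n)"
      unfolding im by (intro measure_mono_fmeasurable) auto
    then show "measure (P n) {j. j + g \<notin> F n} \<le> measure \<nu> (?S n) / measure \<nu> (F n)"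
      by (simp add: measure_P divide_right_mono)
  qed
qed simp

text \<open>
  Translating by \<open>g\<close> moves mass of the averages only along \<open>{j. j + g \<notin> F n}\<close>, whose contribution is
  controlled by uniform integrability, as \<open>f\<close> need not be bounded.
\<close>

lemma sq_diff_shift:
  assumes "x \<in> G" "y \<in> G" and good: "T g x \<in> good" "T g y \<in> good" and "0 < \<kappa>"
  shows "\<forall>\<^sub>F n in sequentially. sq_diff n (T g x) (T g y) \<le> sq_diff n x y + \<kappa>"
proof -
  define E where "E n = {j. j + g \<notin> F n}" for n
  have E [measurable]: "E n \<in> sets borel" for n
    unfolding E_def by measurable
  define h where "h j = (cmod (f (T j x) - f (T j y)))\<^sup>2" for j
  have h_measurable [measurable]: "h \<in> borel_measurable borel"
    unfolding h_def by measurable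
  have h_add: "(cmod (f (T j (T g x)) - f (T j (T g y))))\<^sup>2 = h (j + g)" for j
    by (simp add: h_def T_add)
  have int: "integrable (P n) (\<lambda>j. h (j + g))" for n
    using integrable_orbit_diff[OF good[THEN good_generic]] by (simp add: h_add)
  have int': "integrable \<nu> (\<lambda>j. indicator (F n) j * h j)" for n
    using integrable_orbit_diff[OF assms(1,2), of n]
    by (simp add: integrable_P set_integrable_def h_def[abs_def])
  \<comment> \<open>Points that stay in \<open>F n\<close> after adding \<open>g\<close>: by
    translation invariance their contribution is the integral of \<open>h\<close> over the part of
    \<open>F n\<close> that also lies in \<open>F n\<close> shifted by \<open>g\<close>.\<close>
  have stay: "(\<integral>j. indicator (- E n) j * h (j + g) \<partial>P n) \<le> sq_diff n x y" for n
  proof -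
    let ?\<psi> = "\<lambda>j. indicator (F n) (j + - g) * indicator (F n) j * h j"
    have "(\<integral>j. indicator (- E n) j * h (j + g) \<partial>P n)
        = (\<integral>j. ?\<psi> (j + g) \<partial>\<nu>) / measure \<nu> (F n)"
      unfolding E_def by (subst integral_P)
        (auto simp: set_lebesgue_integral_def indicator_def
          intro!: arg_cong2[where f="(/)"] Bochner_Integration.integral_cong)
    also have "(\<integral>j. ?\<psi> (j + g) \<partial>\<nu>) = (\<integral>j. ?\<psi> j \<partial>distr \<nu> borel (\<lambda>j. j + g))"
      by (rule integral_distr[symmetric]) measurable
    also have "\<dots> = (\<integral>j. ?\<psi> j \<partial>\<nu>)"
      by (simp only: distr_add)
    also have "\<dots> \<le> (\<integral>j. indicator (F n) j * h j \<partial>\<nu>)"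
      using int' by (intro integral_mono') (auto simp: indicator_def h_def)
    also have "\<dots> / measure \<nu> (F n) = sq_diff n x y"
      unfolding sq_diff_def by (simp add: integral_P set_lebesgue_integral_def h_def)
    finally show ?thesis
      using F_measure_pos[of n] by (simp add: divide_right_mono)
  qed
  \<comment> \<open>The escaping part is an integral along the orbits of \<open>T g x\<close> and
    \<open>T g y\<close>; this is why goodness is required of the translated points.\<close>
  obtain \<delta> where "0 < \<delta>" and
    small: "\<forall>\<^sub>F n in sequentially. \<forall>E\<in>sets borel. measure (P n) E \<le> \<delta> \<longrightarrow>
      (\<integral>j. indicator E j * (cmod (f (T j (T g x)) - f (T j (T g y))))\<^sup>2 \<partial>P n) \<le> \<kappa>"
    using uniform_integrability_diff[OF \<open>0 < \<kappa>\<close>] good by blast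
  have "\<forall>\<^sub>F n in sequentially. measure (P n) (E n) < \<delta>"
    using folner_escape[of g] \<open>0 < \<delta>\<close> unfolding E_def by (intro order_tendstoD(2))
  with small have "\<forall>\<^sub>F n in sequentially. (\<integral>j. indicator (E n) j * h (j + g) \<partial>P n) \<le> \<kappa>"
    unfolding h_add
  proof eventually_elim
    case (elim n)
    then show ?case
      using bspec[OF elim(1) E[of n]] by simp
  qed
  then show ?thesis
  proof eventually_elim
    case (elim n)
    have "sq_diff n (T g x) (T g y) =
        (\<integral>j. indicator (- E n) j * h (j + g) + indicator (E n) j * h (j + g) \<partial>P n)"
      unfolding sq_diff_def h_add by (intro Bochner_Integration.integral_cong) (auto simp: indicator_def)
    also have "\<dots> = (\<integral>j. indicator (- E n) j * h (j + g) \<partial>P n) + (\<integral>j. indicator (E n) j * h (j + g) \<partial>P n)"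
      using integrable_mult_indicator[OF _ int[of n], of "- E n"]
        integrable_mult_indicator[OF _ int[of n], of "E n"]
      by (intro Bochner_Integration.integral_add) auto
    also have "\<dots> \<le> sq_diff n x y + \<kappa>"
      using stay elim by (intro add_mono)
    finally show ?case .
  qed
qed

lemma mean_dist_shift_le:
  assumes "x \<in> G" "y \<in> G" "T g x \<in> good" "T g y \<in> good" and "0 \<le> e" and le: "df x y \<le> ereal e"
  shows "df (T g x) (T g y) \<le> ereal e"
  unfolding mean_dist_le_iff[OF \<open>0 \<le> e\<close>]
proof (intro allI impI)
  fix r assume "e < r"
  \<comment> \<open>The intermediate \<open>s\<close> leaves the gap
    \<open>r\<^sup>2 - s\<^sup>2\<close> as the error allowed in the shift.\<close>
  then obtain s where s: "e < s" "s < r"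
    using dense by blast
  then have "s\<^sup>2 < r\<^sup>2"
    using \<open>0 \<le> e\<close> by (intro power_strict_mono) auto
  then have "\<forall>\<^sub>F n in sequentially. sq_diff n (T g x) (T g y) \<le> sq_diff n x y + (r\<^sup>2 - s\<^sup>2)"
    using assms by (intro sq_diff_shift) auto
  moreover have "\<forall>\<^sub>F n in sequentially. sq_diff n x y < s\<^sup>2"
    using le s(1) \<open>0 \<le> e\<close> by (simp add: mean_dist_le_iff)
  ultimately show "\<forall>\<^sub>F n in sequentially. sq_diff n (T g x) (T g y) < r\<^sup>2"
    by eventually_elim simp
qed

lemma mean_dist_shift_le_iff:
  assumes "x \<in> good" "y \<in> good" "T g x \<in> good" "T g y \<in> good" and "0 \<le> e"
  shows "df (T g x) (T g y) \<le> ereal e \<longleftrightarrow> df x y \<le> ereal e"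
proof
  have inverse: "T (- g) (T g z) = z" for z
    by (simp add: T_zero flip: T_add)
  show "df x y \<le> ereal e" if "df (T g x) (T g y) \<le> ereal e"
    using mean_dist_shift_le[of "T g x" "T g y" "- g" e] that assms good_generic by (simp add: inverse)
  show "df (T g x) (T g y) \<le> ereal e" if "df x y \<le> ereal e"
    using mean_dist_shift_le[of x y g e] that assms good_generic by simp
qed

text \<open>Up to the null set of \<open>y\<close> for which \<open>y\<close> or
  \<open>T g y\<close> is not good, the preimage under \<open>T g\<close> of the ball about
  \<open>T g x\<close> is the ball about \<open>x\<close>; the action preserves
  \<open>\<mu>\<close>.\<close>

lemma measure_mean_ball_shift:
  assumes "x \<in> good" "T g x \<in> good" "0 \<le> e"
  shows "measure \<mu> (Bf e (T g x)) = measure \<mu> (Bf e x)"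
proof -
  have "measure \<mu> (Bf e (T g x)) = measure \<mu> (T g -` Bf e (T g x))"
    by (rule T_preserves[symmetric]) (rule mean_ball_measurable)
  also have "\<dots> = measure \<mu> (Bf e x)"
  proof (rule finite_measure_eq_AE)
    show "AE y in \<mu>. y \<in> T g -` Bf e (T g x) \<longleftrightarrow> y \<in> Bf e x"
      using AE_good AE_T[OF AE_good, of g]
    proof eventually_elim
      case (elim y)
      then show ?case
        using mean_dist_shift_le_iff[of x y g e] assms good_generic by (auto simp: mean_ball_def)
    qed
    show "T g -` Bf e (T g x) \<in> sets \<mu>"
      using measurable_sets[OF T_measurable_map mean_ball_measurable, of g e "T g x"] by simp
  qed (rule mean_ball_measurable)
  finally show ?thesis .
qed

section \<open>Ergodicity and the measure of balls\<close>

text \<open>The exceptional null set may depend on \<open>g\<close>, since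
  \<open>ergodic_action\<close> tests one group element at a time. This is needed because
  \<open>good\<close> is not shown to be invariant.\<close>

lemma zero_one_law:
  assumes A: "A \<in> sets \<mu>" and inv: "\<And>g. AE x in \<mu>. T g x \<in> A \<longleftrightarrow> x \<in> A"
  shows "(AE x in \<mu>. x \<notin> A) \<or> (AE x in \<mu>. x \<in> A)"
proof -
  have "emeasure \<mu> (sym_diff (T g -` A \<inter> space \<mu>) A) = 0" for g
  proof -
    have "T g -` A \<inter> space \<mu> \<in> sets \<mu>"
      using measurable_sets[OF T_measurable_map A] .
    then have "sym_diff (T g -` A \<inter> space \<mu>) A \<in> sets \<mu>"
      using A by blast
    moreover have "AE x in \<mu>. x \<notin> sym_diff (T g -` A \<inter> space \<mu>) A"
      using inv[of g] by eventually_elim auto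
    ultimately have "sym_diff (T g -` A \<inter> space \<mu>) A \<in> null_sets \<mu>"
      by (simp only: AE_iff_null_sets)
    then show ?thesis
      by (rule null_setsD1)
  qed
  then have "emeasure \<mu> A = 0 \<or> emeasure \<mu> A = 1"
    using tds A by (simp add: ergodic_TDS_def ergodic_action_def)
  then show ?thesis
    using A AE_iff_null_sets[of A \<mu>] AE_in_set_eq_1[of A] by (auto simp: null_sets_def measure_def)
qed

lemma mean_balls_bounded_below:
  assumes e: "0 \<le> e" and pos: "\<not> (AE x in \<mu>. Bf e x \<in> null_sets \<mu>)"
  obtains c where "0 < c" "AE x in \<mu>. c \<le> measure \<mu> (Bf e x)"
proof -
  \<comment> \<open>Reciprocals of integers give countably many levels: if almost surely each were
    missed, almost every ball would be null. The set where level \<open>k\<close> is reached is then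
    almost invariant.\<close>
  have "\<exists>k::nat. \<not> (AE x in \<mu>. measure \<mu> (Bf e x) < 1 / real (Suc k))"
  proof (rule ccontr)
    assume "\<not> ?thesis"
    then have "AE x in \<mu>. \<forall>k. measure \<mu> (Bf e x) < 1 / real (Suc k)"
      by (simp only: AE_all_countable) blast
    then have "AE x in \<mu>. Bf e x \<in> null_sets \<mu>"
    proof eventually_elim
      case (elim x)
      have "measure \<mu> (Bf e x) \<le> 0"
        using elim nat_approx_posE by (metis less_irrefl less_trans not_le)
      then have "measure \<mu> (Bf e x) = 0"
        by (simp add: measure_le_0_iff)
      then have "emeasure \<mu> (Bf e x) = 0"
        by (simp add: emeasure_eq_measure)
      then show ?case
        using mean_ball_measurable by (rule null_setsI)
    qed
    with pos show False ..
  qed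
  then obtain k :: nat where k: "\<not> (AE x in \<mu>. measure \<mu> (Bf e x) < 1 / real (Suc k))" ..
  define A where "A = {x\<in>space \<mu>. 1 / real (Suc k) \<le> measure \<mu> (Bf e x)}"
  have "A \<in> sets \<mu>"
    unfolding A_def by measurable
  moreover have "AE x in \<mu>. T g x \<in> A \<longleftrightarrow> x \<in> A" for g
    using AE_good AE_T[OF AE_good, of g]
    by eventually_elim (simp add: A_def measure_mean_ball_shift e)
  ultimately have "(AE x in \<mu>. x \<notin> A) \<or> (AE x in \<mu>. x \<in> A)"
    by (rule zero_one_law)
  moreover have "\<not> (AE x in \<mu>. x \<notin> A)"
    using k by (simp add: A_def not_le)
  ultimately have "AE x in \<mu>. x \<in> A"
    by blast
  then show thesis
    by (intro that[of "1 / real (Suc k)"]) (auto simp: A_def)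
qed

section \<open>The four properties\<close>

lemma AE_witness:
  assumes "A \<in> sets \<mu>" "emeasure \<mu> A \<noteq> 0" "AE x in \<mu>. Q x"
  obtains x where "x \<in> A" "Q x"
proof -
  have "\<exists>x. x \<in> A \<and> Q x"
  proof (rule ccontr)
    assume none: "\<not> ?thesis"
    have "AE x in \<mu>. x \<notin> A"
      using assms(3) by eventually_elim (use none in blast)
    then show False
      using assms(1,2) AE_iff_null_sets[of A \<mu>] by auto
  qed
  then show thesis
    using that by blast
qed

lemma mean_ball_null_iff: "Bf e x \<in> null_sets \<mu> \<longleftrightarrow> (AE y in \<mu>. \<not> df x y \<le> ereal e)"
proof -
  have "Bf e x \<in> null_sets \<mu> \<longleftrightarrow> (AE y in \<mu>. y \<notin> Bf e x)"
    by (rule AE_iff_null_sets[OF mean_ball_measurable])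
  also have "\<dots> \<longleftrightarrow> (AE y in \<mu>. \<not> df x y \<le> ereal e)"
    by (rule eventually_cong[OF AE_generic]) (simp add: mean_ball_def)
  finally show ?thesis .
qed

text \<open>A set of pairs has full product measure exactly when almost all its sections have full
  measure. The radius is the same on both sides.\<close>

lemma mean_expansive_iff:
  "mean_expansive \<nu> F \<mu> T f \<longleftrightarrow> (\<exists>e>0. AE x in \<mu>. Bf e x \<in> null_sets \<mu>)"
proof -
  interpret pair_prob_space \<mu> \<mu> ..
  have "emeasure (\<mu> \<Otimes>\<^sub>M \<mu>) {(x, y). x \<in> G \<and> y \<in> G \<and> df x y > ereal e} = 1 \<longleftrightarrow>
      (AE x in \<mu>. Bf e x \<in> null_sets \<mu>)" (is "emeasure _ ?S = 1 \<longleftrightarrow> _") for e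
  proof -
    have S: "{p\<in>space (\<mu> \<Otimes>\<^sub>M \<mu>). fst p \<in> G \<and> snd p \<in> G \<and> case_prod df p > ereal e} \<in> sets (\<mu> \<Otimes>\<^sub>M \<mu>)"
      by measurable
    have S_eq: "{p\<in>space (\<mu> \<Otimes>\<^sub>M \<mu>). fst p \<in> G \<and> snd p \<in> G \<and> df (fst p) (snd p) > ereal e} = ?S"
      "{p\<in>space (\<mu> \<Otimes>\<^sub>M \<mu>). fst p \<in> G \<and> snd p \<in> G \<and> case_prod df p > ereal e} = ?S"
      by (auto simp: space_pair_measure)
    have "emeasure (\<mu> \<Otimes>\<^sub>M \<mu>) ?S = 1 \<longleftrightarrow>
        (AE p in \<mu> \<Otimes>\<^sub>M \<mu>. fst p \<in> G \<and> snd p \<in> G \<and> df (fst p) (snd p) > ereal e)"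
      using S by (subst P.AE_iff_emeasure_eq_1) (simp_all only: S_eq pred_def)
    also have "\<dots> \<longleftrightarrow> (AE x in \<mu>. AE y in \<mu>. x \<in> G \<and> y \<in> G \<and> df x y > ereal e)"
      by (rule pair.AE_pair_iff[symmetric]) (use S in \<open>simp only: S_eq\<close>)
    also have "\<dots> \<longleftrightarrow> (AE x in \<mu>. AE y in \<mu>. \<not> df x y \<le> ereal e)"
    proof (rule eventually_cong[OF AE_generic])
      fix x assume "x \<in> G"
      then show "(AE y in \<mu>. x \<in> G \<and> y \<in> G \<and> df x y > ereal e) \<longleftrightarrow> (AE y in \<mu>. \<not> df x y \<le> ereal e)"
        by (intro eventually_cong[OF AE_generic]) (simp add: not_le)
    qed
    finally show ?thesis
      by (simp only: mean_ball_null_iff)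
  qed
  then show ?thesis
    by (simp only: mean_expansive_def)
qed

text \<open>A non-null ball of radius \<open>e / 2\<close> about a generic point would be a test set
  with all distances at most \<open>e\<close>. Conversely, a set of positive measure contains a
  generic point with null ball, and cannot be covered by that ball.\<close>

lemma mean_sensitive_iff:
  "mean_sensitive \<nu> F \<mu> T f \<longleftrightarrow> (\<exists>e>0. AE x in \<mu>. Bf e x \<in> null_sets \<mu>)"
proof
  assume "mean_sensitive \<nu> F \<mu> T f"
  then obtain e where "0 < e" and sens: "\<And>A. \<lbrakk>A \<in> sets \<mu>; 0 < emeasure \<mu> A\<rbrakk> \<Longrightarrow>
      \<exists>x \<in> A \<inter> G. \<exists>y \<in> A \<inter> G. df x y > ereal e"
    unfolding mean_sensitive_def by blast
  have "AE x in \<mu>. Bf (e / 2) x \<in> null_sets \<mu>"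
    using AE_generic
  proof eventually_elim
    case (elim x)
    show ?case
    proof (rule ccontr)
      assume "Bf (e / 2) x \<notin> null_sets \<mu>"
      then have "0 < emeasure \<mu> (Bf (e / 2) x)"
        using mean_ball_measurable by (auto simp: zero_less_iff_neq_zero intro: null_setsI)
      then obtain y z where "y \<in> Bf (e / 2) x" "z \<in> Bf (e / 2) x" "df y z > ereal e"
        using sens[OF mean_ball_measurable] by blast
      then show False
        using mean_dist_double[of x y z "e / 2"] \<open>x \<in> G\<close> \<open>0 < e\<close> by (auto simp: mean_ball_def)
    qed
  qed
  then show "\<exists>e>0. AE x in \<mu>. Bf e x \<in> null_sets \<mu>"
    using \<open>0 < e\<close> by (intro exI[of _ "e / 2"]) simp
next
  assume "\<exists>e>0. AE x in \<mu>. Bf e x \<in> null_sets \<mu>"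
  then obtain e where "0 < e" and null: "AE x in \<mu>. Bf e x \<in> null_sets \<mu>"
    by blast
  have "\<exists>x \<in> A \<inter> G. \<exists>y \<in> A \<inter> G. df x y > ereal e" if A: "A \<in> sets \<mu>" "0 < emeasure \<mu> A" for A
  proof -
    have "emeasure \<mu> A \<noteq> 0"
      using A(2) by simp
    moreover have "AE x in \<mu>. x \<in> G \<and> Bf e x \<in> null_sets \<mu>"
      using AE_generic null by eventually_elim simp
    ultimately obtain x where x: "x \<in> A" "x \<in> G \<and> Bf e x \<in> null_sets \<mu>"
      by (rule AE_witness[OF A(1)])
    then have "AE y in \<mu>. y \<in> G \<and> \<not> df x y \<le> ereal e"
      using AE_generic by (simp add: mean_ball_null_iff)
    then obtain y where "y \<in> A" "y \<in> G \<and> \<not> df x y \<le> ereal e"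
      by (rule AE_witness[OF A(1) \<open>emeasure \<mu> A \<noteq> 0\<close>])
    then show ?thesis
      using x by (intro bexI[of _ x] bexI[of _ y]) auto
  qed
  then show "mean_sensitive \<nu> F \<mu> T f"
    unfolding mean_sensitive_def using \<open>0 < e\<close> by blast
qed

section \<open>Comparison of the two distances\<close>

lemma upper_density_P:
  "S \<in> sets borel \<Longrightarrow> upper_density \<nu> F S = limsup (\<lambda>n. ereal (measure (P n) S))"
  by (simp add: upper_density_def measure_P)

lemma far_set_measurable [measurable]: "{i. cmod (f (T i x) - f (T i y)) > e} \<in> sets borel"
  by measurable

text \<open>Chebyshev bounds the density of deviations above \<open>e\<close> by about
  \<open>d\<^sup>2 / e\<^sup>2\<close>. The condition \<open>d\<^sup>2 < e ^ 3\<close> makes this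
  less than \<open>e\<close>, so \<open>e\<close> itself competes in the infimum.\<close>

lemma density_dist_le:
  assumes xy: "x \<in> G" "y \<in> G" and "0 < e" "0 \<le> d" and d: "d\<^sup>2 < e ^ 3" and le: "df x y \<le> ereal d"
  shows "density_dist \<nu> F T f x y \<le> e"
proof -
  let ?W = "{i. cmod (f (T i x) - f (T i y)) > e}"
  have "d < sqrt (e ^ 3)"
    using d \<open>0 \<le> d\<close> by (simp add: real_less_rsqrt)
  then obtain r where r: "d < r" "r < sqrt (e ^ 3)"
    using dense by blast
  then have "r\<^sup>2 < e ^ 3"
    using \<open>0 \<le> d\<close> \<open>0 < e\<close> real_sqrt_less_iff[of "r\<^sup>2" "e ^ 3"] by simp
  have "\<forall>\<^sub>F n in sequentially. sq_diff n x y < r\<^sup>2"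
    using le r(1) \<open>0 \<le> d\<close> by (simp add: mean_dist_le_iff)
  then have "\<forall>\<^sub>F n in sequentially. ereal (measure (P n) ?W) \<le> ereal (r\<^sup>2 / e\<^sup>2)"
  proof eventually_elim
    case (elim n)
    interpret P: prob_space "P n"
      by (rule prob_space_P)
    have "?W \<subseteq> {i\<in>space (P n). e\<^sup>2 \<le> (cmod (f (T i x) - f (T i y)))\<^sup>2}"
      using \<open>0 < e\<close> by (auto intro!: power_mono)
    then have "measure (P n) ?W \<le> measure (P n) {i\<in>space (P n). e\<^sup>2 \<le> (cmod (f (T i x) - f (T i y)))\<^sup>2}"
      by (intro P.finite_measure_mono) measurable
    also have "\<dots> \<le> sq_diff n x y / e\<^sup>2"
      unfolding sq_diff_def using \<open>0 < e\<close>
      by (intro integral_Markov_inequality_measure[OF integrable_orbit_diff[OF xy], of "{}"]) auto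
    also have "\<dots> \<le> r\<^sup>2 / e\<^sup>2"
      using elim by (intro divide_right_mono) auto
    finally show ?case
      by simp
  qed
  then have "upper_density \<nu> F ?W \<le> ereal (r\<^sup>2 / e\<^sup>2)"
    unfolding upper_density_P[OF far_set_measurable] by (rule Limsup_bounded)
  also have "\<dots> < ereal e"
    using \<open>r\<^sup>2 < e ^ 3\<close> \<open>0 < e\<close> by (simp add: divide_less_eq power2_eq_square power3_eq_cube)
  finally show ?thesis
    unfolding density_dist_def using \<open>0 < e\<close>
    by (intro cInf_lower) (auto intro!: bdd_belowI[of _ 0])
qed

text \<open>Where the deviation is at most \<open>r\<close> its square contributes at most
  \<open>r\<^sup>2\<close>; the remaining set has small measure, so uniform integrability bounds its
  share.\<close>

lemma mean_dist_le_if_density_dist_le: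
  assumes "0 < \<epsilon>"
  shows "\<exists>e>0. \<forall>x\<in>good. \<forall>y\<in>good. density_dist \<nu> F T f x y \<le> e \<longrightarrow> df x y \<le> ereal \<epsilon>"
proof -
  obtain \<delta> where "0 < \<delta>" and
    \<delta>: "\<forall>x\<in>good. \<forall>y\<in>good. \<forall>\<^sub>F n in sequentially. \<forall>E\<in>sets borel. measure (P n) E \<le> \<delta> \<longrightarrow>
      (\<integral>j. indicator E j * (cmod (f (T j x) - f (T j y)))\<^sup>2 \<partial>P n) \<le> \<epsilon>\<^sup>2 / 2"
    using uniform_integrability_diff[of "\<epsilon>\<^sup>2 / 2"] assms by auto
  \<comment> \<open>The infimum only yields some \<open>r < 2 * e\<close>, hence the halving. Then
    \<open>r\<close> is below \<open>\<delta>\<close> for the exceptional set and below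
    \<open>\<epsilon> / 2\<close> for the rest; the total is at most three quarters of
    \<open>\<epsilon>\<^sup>2\<close>.\<close>
  define e where "e = min \<delta> (\<epsilon> / 2) / 2"
  have "0 < e"
    using \<open>0 < \<delta>\<close> assms by (simp add: e_def)
  moreover have "df x y \<le> ereal \<epsilon>"
    if xy: "x \<in> good" "y \<in> good" and le: "density_dist \<nu> F T f x y \<le> e" for x y
  proof -
    let ?W = "\<lambda>r. {i. cmod (f (T i x) - f (T i y)) > r}"
    let ?X = "{r. r > 0 \<and> upper_density \<nu> F (?W r) < ereal r}"
    \<comment> \<open>Relative measures are at most 1, so 2 is admissible; \<open>cInf_lessD\<close>
      needs a nonempty set.\<close>
    have "upper_density \<nu> F (?W 2) \<le> 1"
      unfolding upper_density_P[OF far_set_measurable]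
      using prob_space.prob_le_1[OF prob_space_P] by (intro Limsup_bounded always_eventually) simp
    also have "\<dots> < ereal 2"
      by simp
    finally have "2 \<in> ?X"
      by simp
    then have "?X \<noteq> {}"
      by blast
    moreover have "Inf ?X < 2 * e"
      using le \<open>0 < e\<close> by (simp add: density_dist_def)
    ultimately have "\<exists>r\<in>?X. r < 2 * e"
      by (rule cInf_lessD)
    then obtain r where r: "0 < r" "r < 2 * e" and W: "upper_density \<nu> F (?W r) < ereal r"
      by auto
    have "r \<le> \<delta>" "r \<le> \<epsilon> / 2"
      using r by (simp_all add: e_def)
    then have "r\<^sup>2 \<le> (\<epsilon> / 2)\<^sup>2"
      using r by (intro power_mono) auto
    have "\<forall>\<^sub>F n in sequentially. measure (P n) (?W r) < r"
      using Limsup_lessD[OF W[unfolded upper_density_P[OF far_set_measurable]]] by simp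
    then have "\<forall>\<^sub>F n in sequentially. sq_diff n x y < \<epsilon>\<^sup>2"
      using bspec[OF bspec[OF \<delta> xy(1)] xy(2)]
    proof eventually_elim
      case (elim n)
      interpret P: prob_space "P n"
        by (rule prob_space_P)
      let ?h = "\<lambda>j. (cmod (f (T j x) - f (T j y)))\<^sup>2"
      have int: "integrable (P n) (\<lambda>j. indicator (?W r) j * ?h j)"
        using integrable_mult_indicator[OF _ integrable_orbit_diff[of x y n], of "?W r"] xy good_generic
        by simp
      have "sq_diff n x y \<le> (\<integral>j. r\<^sup>2 + indicator (?W r) j * ?h j \<partial>P n)"
        unfolding sq_diff_def
        by (intro integral_mono' Bochner_Integration.integrable_add int)
          (auto simp: indicator_def intro!: power_mono)
      also have "\<dots> = r\<^sup>2 + (\<integral>j. indicator (?W r) j * ?h j \<partial>P n)"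
        using int by (subst Bochner_Integration.integral_add) (auto simp: P.prob_space[simplified])
      also have "\<dots> \<le> (\<epsilon> / 2)\<^sup>2 + \<epsilon>\<^sup>2 / 2"
        using elim(1) bspec[OF elim(2) far_set_measurable, of r x y] \<open>r \<le> \<delta>\<close> \<open>r\<^sup>2 \<le> (\<epsilon> / 2)\<^sup>2\<close>
        by (intro add_mono) auto
      also have "\<dots> < \<epsilon>\<^sup>2"
        using assms by (simp add: power_divide)
      finally show ?case .
    qed
    then have "\<forall>\<^sub>F n in sequentially. sq_diff n x y < s\<^sup>2" if "\<epsilon> < s" for s
    proof eventually_elim
      case (elim n)
      then show ?case
        using that assms power_strict_mono[of \<epsilon> s 2] by linarith
    qed
    then show ?thesis
      using assms by (simp add: mean_dist_le_iff)
  qed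
  ultimately show ?thesis
    by blast
qed

section \<open>Equicontinuity and the measure of balls\<close>

text \<open>Some piece of \<open>M\<close> of small diameter has positive measure, and there all
  good points would be within \<open>e\<close>. But almost every centre in the piece has a null
  ball, which cannot contain almost all of the piece.\<close>

lemma not_mean_equicontinuous:
  assumes "0 < e" and null: "AE x in \<mu>. Bf e x \<in> null_sets \<mu>"
  shows "\<not> mean_equicontinuous \<nu> F \<mu> T f"
proof
  assume "mean_equicontinuous \<nu> F \<mu> T f"
  \<comment> \<open>Any tolerance below 1 would do, as only positive measure of \<open>M\<close>
    matters.\<close>
  then have "\<exists>M. compact M \<and> measure \<mu> M \<ge> 1 - 1 / 2 \<and>
      (\<forall>\<epsilon>>0. \<exists>\<delta>>0. \<forall>x\<in>M. \<forall>y\<in>M. dist x y \<le> \<delta> \<longrightarrow> density_dist \<nu> F T f x y \<le> \<epsilon>)"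
    unfolding mean_equicontinuous_def by (elim allE[of _ "1 / 2"]) simp
  then obtain M where M: "compact M" "measure \<mu> M \<ge> 1 / 2"
    and equi: "\<forall>\<epsilon>>0. \<exists>\<delta>>0. \<forall>x\<in>M. \<forall>y\<in>M. dist x y \<le> \<delta> \<longrightarrow> density_dist \<nu> F T f x y \<le> \<epsilon>"
    by auto
  obtain \<epsilon> where "0 < \<epsilon>"
    and \<epsilon>: "\<forall>x\<in>good. \<forall>y\<in>good. density_dist \<nu> F T f x y \<le> \<epsilon> \<longrightarrow> df x y \<le> ereal e"
    using mean_dist_le_if_density_dist_le[OF \<open>0 < e\<close>] by blast
  obtain \<delta> where "0 < \<delta>"
    and \<delta>: "\<forall>x\<in>M. \<forall>y\<in>M. dist x y \<le> \<delta> \<longrightarrow> density_dist \<nu> F T f x y \<le> \<epsilon>"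
    using equi \<open>0 < \<epsilon>\<close> by blast
  have "\<exists>k. finite k \<and> (UNIV :: 'x set) \<subseteq> (\<Union>x\<in>k. ball x (\<delta> / 2))"
    using compact_UNIV \<open>0 < \<delta>\<close> unfolding compact_eq_totally_bounded by simp
  then obtain k :: "'x set" where k: "finite k" "UNIV \<subseteq> (\<Union>x\<in>k. ball x (\<delta> / 2))"
    by blast
  have piece: "M \<inter> ball z (\<delta> / 2) \<in> sets \<mu>" for z
    using M(1) by (simp add: borel_compact sets.Int)
  have "\<exists>z\<in>k. emeasure \<mu> (M \<inter> ball z (\<delta> / 2)) \<noteq> 0"
  proof (rule ccontr)
    assume "\<not> ?thesis"
    then have "(\<Union>z\<in>k. M \<inter> ball z (\<delta> / 2)) \<in> null_sets \<mu>"
      using k(1) piece by (intro null_sets_UN' countable_finite) auto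
    moreover have "(\<Union>z\<in>k. M \<inter> ball z (\<delta> / 2)) = M"
      using k(2) by blast
    ultimately show False
      using M(2) by (auto simp: measure_def)
  qed
  then obtain z where "emeasure \<mu> (M \<inter> ball z (\<delta> / 2)) \<noteq> 0"
    by blast
  note witness = AE_witness[OF piece this]
  have "AE x in \<mu>. x \<in> good \<and> Bf e x \<in> null_sets \<mu>"
    using AE_good null by eventually_elim simp
  then obtain x where x: "x \<in> M \<inter> ball z (\<delta> / 2)" "x \<in> good \<and> Bf e x \<in> null_sets \<mu>"
    by (rule witness)
  then have "AE y in \<mu>. y \<in> good \<and> \<not> df x y \<le> ereal e"
    using AE_good by (simp add: mean_ball_null_iff)
  then obtain y where y: "y \<in> M \<inter> ball z (\<delta> / 2)" "y \<in> good \<and> \<not> df x y \<le> ereal e"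
    by (rule witness)
  have "dist x y \<le> \<delta>"
    using x(1) y(1) dist_triangle2[of x y z] by (auto simp: dist_commute)
  then show False
    using x y \<epsilon> \<delta> by blast
qed

text \<open>
  Balls of radius \<open>e\<close> have measure at least some \<open>c > 0\<close>, so at most \<open>1 / c\<close> of them are disjoint;
  doubling the radii in a maximal disjoint family gives a cover.
\<close>

lemma finite_mean_ball_cover:
  assumes "0 < e" and pos: "\<not> (AE x in \<mu>. Bf e x \<in> null_sets \<mu>)"
  obtains S where "finite S" "S \<subseteq> G" "AE y in \<mu>. y \<in> (\<Union>x\<in>S. Bf (2 * e) x)"
proof -
  obtain c where "0 < c" and c: "AE x in \<mu>. c \<le> measure \<mu> (Bf e x)"
    using mean_balls_bounded_below[OF less_imp_le[OF assms(1)] pos] .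
  define X where "X = {x\<in>G. c \<le> measure \<mu> (Bf e x)}"
  define ok where "ok S \<longleftrightarrow> finite S \<and> S \<subseteq> X \<and> disjoint_family_on (Bf e) S" for S
  have bound: "card S < nat \<lceil>1 / c\<rceil> + 1" if "ok S" for S
  proof -
    have "real (card S) * c \<le> (\<Sum>x\<in>S. measure \<mu> (Bf e x))"
      using that unfolding ok_def X_def by (intro sum_bounded_below) auto
    also have "\<dots> = measure \<mu> (\<Union>x\<in>S. Bf e x)"
      using that mean_ball_measurable unfolding ok_def
      by (intro finite_measure_finite_Union[symmetric]) auto
    also have "\<dots> \<le> 1"
      by (rule prob_le_1)
    finally have "real (card S) \<le> 1 / c"
      using \<open>0 < c\<close> by (simp add: pos_le_divide_eq)
    then show ?thesis
      by linarith
  qed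
  have "ok {}"
    by (simp add: ok_def disjoint_family_on_def)
  then obtain S where S: "ok S" and maximal: "\<And>S'. ok S' \<Longrightarrow> card S' \<le> card S"
    using ex_has_greatest_nat[of ok "{}" card "nat \<lceil>1 / c\<rceil> + 1"] bound by (metis less_imp_le)
  have "y \<in> (\<Union>x\<in>S. Bf (2 * e) x)" if y: "y \<in> X" for y
  proof -
    have "\<exists>x\<in>S. Bf e x \<inter> Bf e y \<noteq> {}"
    proof (rule ccontr)
      assume A: "\<not> ?thesis"
      \<comment> \<open>A nonempty ball meets itself, so \<open>y\<close> is not yet in
        \<open>S\<close> and inserting it really enlarges the family.\<close>
      have "Bf e y \<noteq> {}"
        using y \<open>0 < c\<close> by (auto simp: X_def)
      then have "y \<notin> S"
        using A by auto
      moreover have "ok (insert y S)"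
        using S y A by (auto simp: ok_def disjoint_family_on_def)
      ultimately show False
        using maximal[of "insert y S"] S by (simp add: ok_def)
    qed
    then obtain x z where "x \<in> S" "z \<in> Bf e x" "z \<in> Bf e y"
      by blast
    moreover have "x \<in> G" "y \<in> G"
      using S y \<open>x \<in> S\<close> by (auto simp: ok_def X_def)
    ultimately have "df x y \<le> ereal (2 * e)"
      using mean_dist_double[of z x y e] \<open>0 < e\<close> by (auto simp: mean_ball_def mean_dist_commute)
    then show ?thesis
      using \<open>x \<in> S\<close> \<open>y \<in> G\<close> by (auto simp: mean_ball_def)
  qed
  moreover have "AE y in \<mu>. y \<in> X"
    using AE_generic c by eventually_elim (simp add: X_def)
  ultimately have "AE y in \<mu>. y \<in> (\<Union>x\<in>S. Bf (2 * e) x)"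
    by (auto elim: eventually_mono)
  then show thesis
    using that[of S] S by (auto simp: ok_def X_def)
qed

text \<open>Disjoint compact pieces are uniformly separated, so points of \<open>K\<close> that are
  close enough share a piece, on which \<open>density_dist\<close> is at most
  \<open>\<epsilon>\<close>.\<close>

lemma compact_uniform_modulus:
  assumes pos: "\<And>e. 0 < e \<Longrightarrow> \<not> (AE x in \<mu>. Bf e x \<in> null_sets \<mu>)" and "0 < \<epsilon>" "0 < \<tau>"
  shows "\<exists>K. compact K \<and> 1 - \<tau> \<le> measure \<mu> K \<and>
    (\<exists>\<delta>>0. \<forall>x\<in>K. \<forall>y\<in>K. dist x y \<le> \<delta> \<longrightarrow> density_dist \<nu> F T f x y \<le> \<epsilon>)"
proof -
  \<comment> \<open>The covering balls have radius \<open>2 * e\<close>, so pieces have diameter at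
    most \<open>4 * e\<close>, whose square is a quarter of \<open>\<epsilon> ^ 3\<close>, as
    \<open>density_dist_le\<close> demands.\<close>
  define e where "e = sqrt (\<epsilon> ^ 3) / 8"
  have "0 < e"
    using \<open>0 < \<epsilon>\<close> by (simp add: e_def)
  have small: "(4 * e)\<^sup>2 < \<epsilon> ^ 3"
    using \<open>0 < \<epsilon>\<close> by (simp add: e_def power_mult_distrib power_divide)
  obtain S where S: "finite S" "S \<subseteq> G" and cover: "AE y in \<mu>. y \<in> (\<Union>x\<in>S. Bf (2 * e) x)"
    using finite_mean_ball_cover[OF \<open>0 < e\<close> pos[OF \<open>0 < e\<close>]] .
  define k where "k = card S"
  obtain p where p: "bij_betw p {0..<k} S"
    using ex_bij_betw_nat_finite[OF S(1)] unfolding k_def by blast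
  define A where "A = disjointed (\<lambda>i. Bf (2 * e) (p i))"
  have "range A \<subseteq> sets \<mu>"
    unfolding A_def using mean_ball_measurable by (intro sets.range_disjointed_sets) auto
  then have A_sets: "A i \<in> sets \<mu>" for i
    by blast
  have A_disj: "disjoint_family A"
    unfolding A_def by (rule disjoint_family_disjointed)
  have "(\<Union>i\<in>{0..<k}. A i) = (\<Union>x\<in>S. Bf (2 * e) x)"
    unfolding A_def finite_UN_disjointed_eq using bij_betw_imp_surj_on[OF p] by blast
  then have "AE y in \<mu>. y \<in> (\<Union>i\<in>{0..<k}. A i)"
    using cover by simp
  then have "measure \<mu> (\<Union>i\<in>{0..<k}. A i) = 1"
    using A_sets by (subst (asm) AE_in_set_eq_1) auto
  then have A_sum: "(\<Sum>i\<in>{0..<k}. measure \<mu> (A i)) = 1"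
    using A_sets A_disj
    by (subst (asm) finite_measure_finite_Union) (auto simp: disjoint_family_on_def)
  have A_close: "density_dist \<nu> F T f y z \<le> \<epsilon>" if "i < k" "y \<in> A i" "z \<in> A i" for i y z
  proof -
    have "y \<in> Bf (2 * e) (p i)" "z \<in> Bf (2 * e) (p i)"
      using that disjointed_subset[of "\<lambda>i. Bf (2 * e) (p i)" i] unfolding A_def by blast+
    moreover have "p i \<in> G"
      using p \<open>i < k\<close> S(2) by (auto simp: bij_betw_def)
    ultimately show ?thesis
      using mean_dist_double[of "p i" y z "2 * e"] small \<open>0 < e\<close> \<open>0 < \<epsilon>\<close>
      by (intro density_dist_le[where d="4 * e"]) (auto simp: mean_ball_def)
  qed
  \<comment> \<open>Each of the \<open>k\<close> pieces may lose this much, in total at most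
    \<open>\<tau>\<close>; \<open>Suc k\<close> avoids a division by zero.\<close>
  have "\<exists>C. compact C \<and> C \<subseteq> A i \<and> measure \<mu> (A i) - \<tau> / real (Suc k) \<le> measure \<mu> C" for i
  proof -
    have "0 < \<tau> / real (Suc k)"
      using \<open>0 < \<tau>\<close> by simp
    then show ?thesis
      by (rule compact_inner_regular[OF compact_UNIV sets_\<mu> finite_measure_axioms A_sets]) blast
  qed
  then obtain C where C: "\<And>i. compact (C i)" "\<And>i. C i \<subseteq> A i"
      "\<And>i. measure \<mu> (A i) - \<tau> / real (Suc k) \<le> measure \<mu> (C i)"
    by metis
  define K where "K = (\<Union>i\<in>{0..<k}. C i)"
  have "compact K"
    unfolding K_def using C(1) by (intro compact_UN) auto
  moreover have "1 - \<tau> \<le> measure \<mu> K"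
  proof -
    have "real k * (\<tau> / real (Suc k)) \<le> \<tau>"
      using \<open>0 < \<tau>\<close> by (simp add: field_simps)
    then have "1 - \<tau> \<le> (\<Sum>i\<in>{0..<k}. measure \<mu> (A i) - \<tau> / real (Suc k))"
      using A_sum by (simp add: sum_subtractf)
    also have "\<dots> \<le> (\<Sum>i\<in>{0..<k}. measure \<mu> (C i))"
      by (intro sum_mono C(3))
    also have "\<dots> = measure \<mu> K"
      unfolding K_def using C(1,2) A_disj
      by (intro finite_measure_finite_Union[symmetric])
        (auto simp: disjoint_family_on_def borel_compact, blast)
    finally show ?thesis .
  qed
  moreover have "\<exists>\<delta>>0. \<forall>x\<in>K. \<forall>y\<in>K. dist x y \<le> \<delta> \<longrightarrow> density_dist \<nu> F T f x y \<le> \<epsilon>"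
  proof -
    \<comment> \<open>\<open>U i\<close> meets \<open>K\<close> only in \<open>C i\<close>. Half a
      Lebesgue number of this open cover serves as modulus.\<close>
    define U where "U i = - (\<Union>j\<in>{0..<k} - {i}. C j)" for i
    have "open (U i)" for i
      unfolding U_def using C(1) by (intro open_Compl closed_UN) (auto intro: compact_imp_closed)
    then have U_open: "open V" if "V \<in> U ` {0..<k}" for V
      using that by blast
    have "C i \<inter> C j = {}" if "i \<noteq> j" for i j
      using C(2)[of i] C(2)[of j] disjoint_family_onD[OF A_disj _ _ that] by blast
    then have "C i \<subseteq> U i" for i
      unfolding U_def by blast
    then have K_cover: "K \<subseteq> \<Union> (U ` {0..<k})"
      unfolding K_def by blast
    obtain d where "0 < d" and d: "\<forall>x\<in>K. \<exists>V\<in>U ` {0..<k}. ball x d \<subseteq> V"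
    proof (rule Heine_Borel_lemma[OF \<open>compact K\<close> K_cover U_open])
      fix \<eta> :: real
      assume "0 < \<eta>" and "\<And>x. x \<in> K \<Longrightarrow> \<exists>V\<in>U ` {0..<k}. ball x \<eta> \<subseteq> V"
      then show thesis
        by (intro that[of \<eta>] ballI)
    qed
    have "density_dist \<nu> F T f x y \<le> \<epsilon>" if "x \<in> K" "y \<in> K" "dist x y \<le> d / 2" for x y
    proof -
      obtain i where i: "i < k" "ball x d \<subseteq> U i"
        using bspec[OF d \<open>x \<in> K\<close>] by auto
      moreover have "x \<in> ball x d" "y \<in> ball x d"
        using \<open>0 < d\<close> that(3) by auto
      ultimately have "x \<in> U i" "y \<in> U i"
        by auto
      then have "x \<in> C i" "y \<in> C i"
        using that(1,2) unfolding K_def U_def by auto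
      then show ?thesis
        using A_close[OF i(1)] C(2) by blast
    qed
    then show ?thesis
      using \<open>0 < d\<close> by (intro exI[of _ "d / 2"]) simp
  qed
  ultimately show ?thesis
    by blast
qed

text \<open>The compact set has to be chosen before \<open>\<epsilon>\<close>. Intersecting the sets
  for the tolerances \<open>1 / real (Suc m)\<close> achieves this, and the allowed losses, halved
  at each step, sum to \<open>\<tau>\<close>.\<close>

lemma mean_equicontinuousI:
  assumes pos: "\<And>e. 0 < e \<Longrightarrow> \<not> (AE x in \<mu>. Bf e x \<in> null_sets \<mu>)"
  shows "mean_equicontinuous \<nu> F \<mu> T f"
  unfolding mean_equicontinuous_def
proof (intro allI impI)
  fix \<tau> :: real assume "0 < \<tau>"
  have "\<exists>K. compact K \<and> 1 - \<tau> * (1 / 2) ^ Suc m \<le> measure \<mu> K \<and>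
      (\<exists>\<delta>>0. \<forall>x\<in>K. \<forall>y\<in>K. dist x y \<le> \<delta> \<longrightarrow> density_dist \<nu> F T f x y \<le> 1 / real (Suc m))" for m
    using \<open>0 < \<tau>\<close> by (intro compact_uniform_modulus pos) auto
  then obtain K where K: "\<And>m. compact (K m)" "\<And>m. 1 - \<tau> * (1 / 2) ^ Suc m \<le> measure \<mu> (K m)"
    "\<And>m. \<exists>\<delta>>0. \<forall>x\<in>K m. \<forall>y\<in>K m. dist x y \<le> \<delta> \<longrightarrow> density_dist \<nu> F T f x y \<le> 1 / real (Suc m)"
    by metis
  have K_sets: "K m \<in> sets \<mu>" for m
    using K(1) by (simp add: borel_compact)
  define M where "M = (\<Inter>m. K m)"
  have "compact M"
    unfolding M_def using compact_Int_closed[OF K(1)[of 0], of "\<Inter>m. K m"] K(1)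
    by (simp add: closed_INT compact_imp_closed Int_absorb1 INT_lower)
  moreover have "1 - \<tau> \<le> measure \<mu> M"
  proof -
    have sums: "(\<lambda>m. \<tau> * (1 / 2) ^ Suc m) sums \<tau>"
      using sums_mult[OF power_half_series, of \<tau>] by simp
    have le: "measure \<mu> (- K m) \<le> \<tau> * (1 / 2) ^ Suc m" for m
      using prob_compl[OF K_sets[of m]] K(2)[of m] by (simp add: Compl_eq_Diff_UNIV)
    have summable: "summable (\<lambda>m. measure \<mu> (- K m))"
      by (rule summable_comparison_test'[OF sums_summable[OF sums]]) (use le in auto)
    have "measure \<mu> (- M) = measure \<mu> (\<Union>m. - K m)"
      unfolding M_def by simp
    also have "\<dots> \<le> (\<Sum>m. measure \<mu> (- K m))"
      using K_sets summable by (intro finite_measure_subadditive_countably) auto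
    also have "\<dots> \<le> (\<Sum>m. \<tau> * (1 / 2) ^ Suc m)"
      by (intro suminf_le le summable sums_summable[OF sums])
    also have "\<dots> = \<tau>"
      using sums by (simp add: sums_iff)
    finally show ?thesis
      using prob_compl[of M] \<open>compact M\<close> by (simp add: Compl_eq_Diff_UNIV borel_compact)
  qed
  moreover have "\<exists>\<delta>>0. \<forall>x\<in>M. \<forall>y\<in>M. dist x y \<le> \<delta> \<longrightarrow> density_dist \<nu> F T f x y \<le> \<epsilon>" if "0 < \<epsilon>" for \<epsilon>
  proof -
    obtain m where m: "1 / real (Suc m) < \<epsilon>"
      by (rule nat_approx_posE[OF \<open>0 < \<epsilon>\<close>])
    obtain \<delta> where "0 < \<delta>"
      and \<delta>: "\<forall>x\<in>K m. \<forall>y\<in>K m. dist x y \<le> \<delta> \<longrightarrow> density_dist \<nu> F T f x y \<le> 1 / real (Suc m)"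
      using K(3)[of m] by blast
    have "density_dist \<nu> F T f x y \<le> \<epsilon>" if "x \<in> M" "y \<in> M" "dist x y \<le> \<delta>" for x y
    proof -
      have "density_dist \<nu> F T f x y \<le> 1 / real (Suc m)"
        using \<delta> that unfolding M_def by blast
      then show ?thesis
        using m by linarith
    qed
    then show ?thesis
      using \<open>0 < \<delta>\<close> by blast
  qed
  ultimately show "\<exists>M. compact M \<and> measure \<mu> M \<ge> 1 - \<tau> \<and>
      (\<forall>\<epsilon>>0. \<exists>\<delta>>0. \<forall>x\<in>M. \<forall>y\<in>M. dist x y \<le> \<delta> \<longrightarrow> density_dist \<nu> F T f x y \<le> \<epsilon>)"
    by blast
qed

end

theorem theorem3p7:
  fixes \<nu> :: "'g::{topological_ab_group_add, t2_space} measure"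
    and F :: "nat \<Rightarrow> 'g set"
    and \<mu> :: "'x::metric_space measure"
    and T :: "'g \<Rightarrow> 'x \<Rightarrow> 'x"
    and f :: "'x \<Rightarrow> complex"
  assumes "locally_compact_space (euclidean :: 'g topology)"
    and "haar_measure \<nu>"
    and "folner_sequence \<nu> F"
    and "satisfies_pointwise_ergodic_theorem \<nu> F"
    and "ergodic_TDS \<mu> T"
    and "square_integrable \<mu> f"
  shows "(mean_sensitive \<nu> F \<mu> T f \<longleftrightarrow> mean_expansive \<nu> F \<mu> T f) \<and>
         (mean_expansive \<nu> F \<mu> T f \<longleftrightarrow>
            (\<exists>\<epsilon>>0. AE x in \<mu>. mean_ball \<nu> F \<mu> T f \<epsilon> x \<in> null_sets \<mu>)) \<and>
         ((\<exists>\<epsilon>>0. AE x in \<mu>. mean_ball \<nu> F \<mu> T f \<epsilon> x \<in> null_sets \<mu>) \<longleftrightarrow>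
            \<not> mean_equicontinuous \<nu> F \<mu> T f)"
proof -
  interpret folner_TDS \<nu> F \<mu> T f
    using assms(2-) by unfold_locales
  show ?thesis
    using mean_sensitive_iff mean_expansive_iff not_mean_equicontinuous mean_equicontinuousI by blast
qed

end
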